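(* Let $\mu$ be a positive, finite Borel measure on $\mathbb{R}^3$, and suppose that the maximal function $$M_{\mu} g(x) := \sup_{t > 0} \, (|g|*\mu_t)(x)$$ is bounded from $L^2(\mathbb{R}^3)$ to $L^2(\mathbb{R}^3)$. Let $1 \le p \le \frac{4}{3}$. Then there is a constant $C=C_{p,\mu}$ such that $$\|M_{\mu}(\widehat{f})\|_{L^2(\mathbb{S}^2)} \le C \|f\|_{L^{p}(\mathbb{R}^3)}$$ for all Schwartz functions $f\in\mathcal{S}(\mathbb{R}^3)$.
   Context: For $t>0$, the dilate $\mu_t$ of $\mu$ is defined by $\mu_t(E) := \mu(t^{-1}E)$, so that $(|g|*\mu_t)(x) = \int |g(x-ty)|\,d\mu(y)$. The Fourier transform is $\widehat{f}(\xi) = \int_{\mathbb{R}^d} e^{-2\pi i x\cdot \xi} f(x)\,dx$. The sphere $\mathbb{S}^2\subset\mathbb{R}^3$ is equipped with its surface measure. *)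

theory Defs
  imports "HOL-Analysis.Analysis"
begin

fun iterated_partial ::
    "'a::euclidean_space list \<Rightarrow> ('a \<Rightarrow> complex) \<Rightarrow> 'a \<Rightarrow> complex" where
  "iterated_partial [] f = f"
| "iterated_partial (b # bs) f = (\<lambda>x. frechet_derivative (iterated_partial bs f) (at x) b)"

text \<open>
  The multi-index derivatives are given by lists of standard basis vectors. A function is smooth
  iff all its iterated partial derivatives exist and are (totally) differentiable everywhere.
\<close>

definition schwartz :: "('a::euclidean_space \<Rightarrow> complex) \<Rightarrow> bool" where
  "schwartz f \<longleftrightarrow> (\<forall>bs. set bs \<subseteq> Basis \<longrightarrow>
     (\<forall>x. iterated_partial bs f differentiable (at x)) \<and>
     (\<forall>N::nat. bounded (range (\<lambda>x. (norm x ^ N) *\<^sub>R iterated_partial bs f x))))"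

definition fourier :: "('a::euclidean_space \<Rightarrow> complex) \<Rightarrow> 'a \<Rightarrow> complex" where
  "fourier f \<xi> =
     (\<integral>x. exp (- 2 * of_real pi * \<i> * of_real (x \<bullet> \<xi>)) * f x \<partial>lborel)"

text \<open>
  The surface measure of the unit sphere in polar coordinates: the measure of a Borel set \<open>E\<close> of
  unit vectors is the dimension times the Lebesgue measure of the cone
  \<open>{x. 0 < norm x \<le> 1 \<and> x / norm x \<in> E}\<close>. On nonzero vectors, \<open>sgn x = x / norm x\<close>.
\<close>

definition sphere_measure :: "'a::euclidean_space measure" where
  "sphere_measure =
     scale_measure (of_nat DIM('a))
       (distr (restrict_space lborel (cball 0 1 - {0})) (restrict_space borel (sphere 0 1)) sgn)"

lemma sgn_measurable_sphere:
  "sgn \<in> measurable (restrict_space lborel (cball 0 1 - {0}))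
           (restrict_space borel (sphere 0 (1::real)) :: 'a::euclidean_space measure)"
proof (rule measurable_restrict_space2)
  show "sgn \<in> space (restrict_space lborel (cball 0 1 - {0::'a})) \<rightarrow> sphere 0 1"
    by (auto simp: space_restrict_space norm_sgn)
  have "(\<lambda>x::'a. x /\<^sub>R norm x) \<in> borel_measurable borel" by measurable
  then have "(sgn :: 'a \<Rightarrow> 'a) \<in> borel_measurable borel"
    by (simp add: sgn_div_norm[abs_def])
  then show "sgn \<in> borel_measurable (restrict_space lborel (cball 0 1 - {0::'a}))"
    by (intro measurable_restrict_space1) simp
qed

lemma emeasure_sphere_measure:
  fixes E :: "'a::euclidean_space set"
  assumes "E \<in> sets borel" "E \<subseteq> sphere 0 1"
  shows "emeasure sphere_measure E =
           of_nat DIM('a) * emeasure lborel {x. 0 < norm x \<and> norm x \<le> 1 \<and> x /\<^sub>R norm x \<in> E}"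
proof -
  have "E \<in> sets (restrict_space borel (sphere 0 1))"
    using assms by (auto simp: sets_restrict_space_iff)
  moreover have "sgn -` E \<inter> (cball 0 1 - {0}) =
      {x. 0 < norm x \<and> norm x \<le> 1 \<and> x /\<^sub>R norm x \<in> E}"
    by (auto simp: sgn_div_norm)
  moreover have "emeasure (restrict_space lborel (cball 0 1 - {0}))
        {x. 0 < norm x \<and> norm x \<le> 1 \<and> x /\<^sub>R norm x \<in> E} =
      emeasure lborel {x. 0 < norm x \<and> norm x \<le> 1 \<and> x /\<^sub>R norm x \<in> E}"
    by (rule emeasure_restrict_space) auto
  ultimately show ?thesis
    unfolding sphere_measure_def
    by (simp add: emeasure_distr[OF sgn_measurable_sphere] space_restrict_space)
qed

lemma emeasure_sphere_measure_S2:
  "emeasure sphere_measure (sphere (0 :: real^3) 1) = ennreal (4 * pi)"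
proof -
  have *: "{x :: real^3. 0 < norm x \<and> norm x \<le> 1 \<and> x /\<^sub>R norm x \<in> sphere 0 1} = cball 0 1 - {0}"
    by auto
  have "emeasure lborel (cball 0 1 - {0 :: real^3}) = emeasure lborel (cball (0 :: real^3) 1)"
    by (intro emeasure_Diff_null_set) (auto simp: finite_imp_null_set_lborel)
  also have "\<dots> = ennreal (4 / 3 * pi)"
    by (simp add: emeasure_cball eval_unit_ball_vol)
  finally show ?thesis
    unfolding emeasure_sphere_measure[OF borel_closed[OF closed_sphere] order_refl] *
    by (simp flip: ennreal_numeral ennreal_mult')
qed

definition dilate :: "real \<Rightarrow> 'a::euclidean_space measure \<Rightarrow> 'a measure" where
  "dilate t \<mu> = distr \<mu> borel (\<lambda>y. t *\<^sub>R y)"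

definition abs_conv :: "('a::euclidean_space \<Rightarrow> complex) \<Rightarrow> 'a measure \<Rightarrow> 'a \<Rightarrow> ennreal" where
  "abs_conv g \<nu> x = (\<integral>\<^sup>+y. ennreal (norm (g (x - y))) \<partial>\<nu>)"

definition maximal_fun :: "'a::euclidean_space measure \<Rightarrow> ('a \<Rightarrow> complex) \<Rightarrow> 'a \<Rightarrow> ennreal" where
  "maximal_fun \<mu> g x = (SUP t\<in>{0<..}. abs_conv g (dilate t \<mu>) x)"

text \<open>Powers with a positive exponent, extended by \<open>\<infinity>\<^sup>a = \<infinity>\<close>.\<close>

definition epowr :: "ennreal \<Rightarrow> real \<Rightarrow> ennreal" where
  "epowr x a = (if x = \<infinity> then \<infinity> else ennreal (enn2real x powr a))"

text \<open>The (possibly infinite) \<open>L\<^sup>p\<close> norm of a nonnegative extended function, \<open>0 < p < \<infinity>\<close>.\<close>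

definition Lp_enorm :: "real \<Rightarrow> 'a measure \<Rightarrow> ('a \<Rightarrow> ennreal) \<Rightarrow> ennreal" where
  "Lp_enorm p M F = epowr (\<integral>\<^sup>+x. epowr (F x) p \<partial>M) (1 / p)"

text \<open>
  A maximal function depends on its argument pointwise, as \<open>\<mu>\<close> may be singular. Boundedness is
  required for every Borel representative with finite \<open>L\<^sup>2\<close> norm. This finiteness is stated because
  \<open>0 * \<infinity> = 0\<close>. The maximal function of a Borel function is Lebesgue measurable but need not be
  Borel; \<open>nn_integral\<close>, a supremum over simple functions from below, still gives its integral.
\<close>

definition maximal_bounded_L2 :: "'a::euclidean_space measure \<Rightarrow> bool" where
  "maximal_bounded_L2 \<mu> \<longleftrightarrow> (\<exists>A::real. \<forall>g\<in>borel_measurable borel.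
     Lp_enorm 2 lborel (\<lambda>x. ennreal (norm (g x))) < \<infinity> \<longrightarrow>
     Lp_enorm 2 lborel (maximal_fun \<mu> g)
       \<le> ennreal A * Lp_enorm 2 lborel (\<lambda>x. ennreal (norm (g x))))"

end

theory Submission
  imports Defs "HOL-Probability.Probability" "HOL-Real_Asymp.Real_Asymp"
begin

text \<open>
  The transform \<open>F\<close> of a Schwartz function \<open>f\<close> is continuous, so its maximal function is a supremum
  over rational times only, and by monotone convergence it suffices to control, uniformly over
  measurable choices \<open>\<tau>\<close> of a rational time, the function \<open>a(x) = \<integral> |F(x - \<tau>(x) y)| d\<mu>(y)\<close> in
  \<open>L\<^sup>2\<close> of the sphere. Writing \<open>|F| = w F\<close> with \<open>|w| \<le> 1\<close> gives \<open>\<integral> a\<^sup>2 d\<sigma> = \<integral> f K\<close>, where \<open>K\<close> is the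
  Fourier transform of a complex measure \<open>\<nu>\<close>: the image of \<open>a w d\<sigma> d\<mu>\<close> under
  \<open>(x, y) \<mapsto> x - \<tau>(x) y\<close>. The conjugate exponent of \<open>p\<close> is at least 4, so two bounds for \<open>K\<close> suffice.
  The supremum bound \<open>|K| \<le> c \<parallel>a\<parallel>\<^sub>2\<close> is the Cauchy-Schwarz inequality. The other is
  \<open>\<parallel>K\<parallel>\<^sub>4 \<le> c \<parallel>a\<parallel>\<^sub>2\<close>, and it carries the proof.

  The square of \<open>K\<close> is the transform of \<open>\<nu> * \<nu>\<close>. Testing it against a function \<open>\<psi>\<close> and moving the
  Fourier transform to \<open>\<psi>\<close> leaves the integral of the transform \<open>g\<close> of \<open>\<psi>\<close> against \<open>\<nu> * \<nu>\<close>. With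
  absolute values inside, the integrations over the two copies of \<open>\<mu>\<close> are dominated by
  the iterated maximal function \<open>H = M\<^sub>\<mu> M\<^sub>\<mu> g\<close>, whatever \<open>\<tau>\<close> is, and what remains is
  \<open>\<integral>\<integral> a(x) a(x') H(x + x') d\<sigma>(x) d\<sigma>(x')\<close>. By the hypothesis, used twice, and the Plancherel
  inequality, \<open>\<parallel>H\<parallel>\<^sub>2 \<le> c \<parallel>\<psi>\<parallel>\<^sub>2\<close> (lemmas \<open>iterated_maximal_majorant\<close>, \<open>fourier_L2_le\<close>). The measure
  \<open>\<mu>\<close> has now disappeared: the estimate has become the endpoint restriction estimate for the sphere
  in its bilinear form \<open>\<parallel>a\<sigma> * a\<sigma>\<parallel>\<^sub>2 \<le> c \<parallel>a\<parallel>\<^sub>2\<^sup>2\<close>.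

  By the Cauchy-Schwarz inequality, this form follows wherever \<open>\<sigma> * \<sigma>\<close> has a bounded density. That
  density is proportional to \<open>1/|z|\<close> on \<open>|z| < 2\<close>, and it blows up only because of nearly
  antipodal points. Hence the sphere is cut into its eight orthants at the very beginning: two
  points of the same orthant have a nonnegative inner product, so their sum has norm at least
  \<open>\<surd>2\<close> (lemma \<open>orthant_convolution_le\<close>). The bounded density itself is seen by thickening: for
  \<open>|z| \<ge> 1/2\<close>, two spherical shells of width \<open>\<delta>\<close> with centres \<open>0\<close> and \<open>z\<close> meet in a set of volume
  \<open>O(\<delta>\<^sup>2)\<close>.
\<close>

section \<open>Characters and the Fourier transform\<close>

definition character :: "'a::euclidean_space \<Rightarrow> 'a \<Rightarrow> complex" where
  "character x \<xi> = cis (- 2 * pi * (x \<bullet> \<xi>))"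

lemma fourier_eq_character: "fourier f \<xi> = (\<integral>x. f x * character x \<xi> \<partial>lborel)"
  unfolding fourier_def character_def cis_conv_exp
  by (intro Bochner_Integration.integral_cong refl) (simp add: mult_ac)

lemma norm_character [simp]: "norm (character x \<xi>) = 1"
  by (simp add: character_def)

lemma character_commute: "character x \<xi> = character \<xi> x"
  by (simp add: character_def inner_commute)

lemma character_add: "character (x + y) \<xi> = character x \<xi> * character y \<xi>"
  by (simp add: character_def cis_mult inner_add_left algebra_simps)

lemma character_minus: "character (- x) \<xi> = cnj (character x \<xi>)"
  by (simp add: character_def cis_cnj)

lemma continuous_character: "continuous_on UNIV (\<lambda>(x, \<xi>). character x \<xi>)"
  unfolding character_def cis_conv_exp split_beta by (intro continuous_intros)

lemma measurable_character [measurable (raw)]: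
  assumes "f \<in> borel_measurable M" "g \<in> borel_measurable M"
  shows "(\<lambda>x. character (f x) (g x)) \<in> borel_measurable M"
  using borel_measurable_continuous_Pair[OF assms, of character]
    continuous_character by (simp add: split_beta)

lemma continuous_fourier:
  assumes "integrable lborel f"
  shows "continuous_on UNIV (fourier f)"
proof -
  have [measurable]: "f \<in> borel_measurable borel"
    using assms by (simp add: borel_measurable_integrable[of lborel, simplified])
  show ?thesis
    unfolding continuous_on_sequentially comp_def
  proof safe
    fix X :: "nat \<Rightarrow> 'a" and \<xi> assume X: "X \<longlonglongrightarrow> \<xi>"
    show "(\<lambda>n. fourier f (X n)) \<longlonglongrightarrow> fourier f \<xi>"
      unfolding fourier_eq_character
    proof (rule integral_dominated_convergence[where w="\<lambda>x. norm (f x)"])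
      show "AE x in lborel. (\<lambda>n. f x * character x (X n)) \<longlonglongrightarrow> f x * character x \<xi>"
        unfolding character_def cis_conv_exp by (intro always_eventually allI tendsto_intros X)
    qed (use assms in \<open>auto simp: norm_mult\<close>)
  qed
qed

lemma measurable_fourier [measurable (raw)]:
  assumes "integrable lborel f" "g \<in> borel_measurable M"
  shows "(\<lambda>x. fourier f (g x)) \<in> borel_measurable M"
  using measurable_compose[OF assms(2) borel_measurable_continuous_onI[OF continuous_fourier[OF assms(1)]]] .

lemma norm_fourier_le: "norm (fourier f \<xi>) \<le> (\<integral>x. norm (f x) \<partial>lborel)"
  unfolding fourier_eq_character by (rule order.trans[OF integral_norm_bound]) (simp add: norm_mult)

text \<open>
  By Fubini's theorem, the Fourier transform moves from one factor of a pairing to the other. Here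
  one factor is the function \<open>f\<close> and the other is the complex measure \<open>\<nu>\<close> obtained by pushing
  \<open>W dM\<close> forward along \<open>\<phi>\<close>. With Lebesgue measure and \<open>\<phi>(x) = x\<close> this is the symmetric formula for
  two functions; the general form serves for \<open>\<nu>\<close> and \<open>\<nu> * \<nu>\<close>, which may be singular.
\<close>

lemma integral_fourier_swap:
  fixes f :: "'a::euclidean_space \<Rightarrow> complex"
  assumes "sigma_finite_measure M" and \<phi>[measurable]: "\<phi> \<in> borel_measurable M"
    and W: "integrable M W" and f: "integrable lborel f"
  shows "(\<integral>\<xi>. f \<xi> * (\<integral>\<omega>. W \<omega> * character (\<phi> \<omega>) \<xi> \<partial>M) \<partial>lborel)
       = (\<integral>\<omega>. W \<omega> * fourier f (\<phi> \<omega>) \<partial>M)"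
proof -
  interpret M: sigma_finite_measure M by fact
  interpret P: pair_sigma_finite lborel M ..
  have [measurable]: "f \<in> borel_measurable borel" "W \<in> borel_measurable M"
    using f W by (simp_all add: borel_measurable_integrable[of lborel, simplified])
  have int: "integrable (lborel \<Otimes>\<^sub>M M) (\<lambda>(\<xi>, \<omega>). f \<xi> * (W \<omega> * character (\<phi> \<omega>) \<xi>))"
  proof (rule P.Fubini_integrable)
    have "(\<lambda>\<omega>. norm (f \<xi> * (W \<omega> * character (\<phi> \<omega>) \<xi>))) = (\<lambda>\<omega>. norm (f \<xi>) * norm (W \<omega>))" for \<xi>
      by (simp add: norm_mult fun_eq_iff)
    then show "integrable lborel
        (\<lambda>\<xi>. \<integral>\<omega>. norm (case (\<xi>, \<omega>) of (\<xi>, \<omega>) \<Rightarrow> f \<xi> * (W \<omega> * character (\<phi> \<omega>) \<xi>)) \<partial>M)"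
      using f by simp
    have "integrable M (\<lambda>\<omega>. W \<omega> * character (\<phi> \<omega>) \<xi>)" for \<xi>
      by (rule Bochner_Integration.integrable_bound[OF W]) (auto simp: norm_mult)
    then show "AE \<xi> in lborel. integrable M
        (\<lambda>\<omega>. case (\<xi>, \<omega>) of (\<xi>, \<omega>) \<Rightarrow> f \<xi> * (W \<omega> * character (\<phi> \<omega>) \<xi>))"
      by auto
  qed measurable
  have "(\<integral>\<xi>. f \<xi> * (\<integral>\<omega>. W \<omega> * character (\<phi> \<omega>) \<xi> \<partial>M) \<partial>lborel)
      = (\<integral>\<xi>. (\<integral>\<omega>. f \<xi> * (W \<omega> * character (\<phi> \<omega>) \<xi>) \<partial>M) \<partial>lborel)"
    by simp
  also have "\<dots> = (\<integral>\<omega>. (\<integral>\<xi>. f \<xi> * (W \<omega> * character (\<phi> \<omega>) \<xi>) \<partial>lborel) \<partial>M)"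
    using P.Fubini_integral[OF int] by simp
  also have "\<dots> = (\<integral>\<omega>. W \<omega> * fourier f (\<phi> \<omega>) \<partial>M)"
    unfolding fourier_eq_character
    by (subst integral_mult_right_zero[symmetric])
      (auto intro!: Bochner_Integration.integral_cong simp: mult_ac character_commute)
  finally show ?thesis .
qed

lemma integral_lborel_prod:
  fixes f :: "'a::euclidean_space \<Rightarrow> real \<Rightarrow> complex"
  assumes "\<And>b. b \<in> Basis \<Longrightarrow> integrable lborel (f b)"
  shows "integral\<^sup>L lborel (\<lambda>x. \<Prod>b\<in>Basis. f b (x \<bullet> b)) = (\<Prod>b\<in>Basis. integral\<^sup>L lborel (f b))"
    and "integrable lborel (\<lambda>x. \<Prod>b\<in>Basis. f b (x \<bullet> b))"
proof -
  interpret product_sigma_finite "\<lambda>b::'a. lborel :: real measure" ..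
  have [measurable]: "f b \<in> borel_measurable borel" if "b \<in> Basis" for b
    using assms[OF that] by (simp add: borel_measurable_integrable[of lborel, simplified])
  have m: "(\<lambda>f. \<Sum>b\<in>Basis. f b *\<^sub>R b) \<in> borel_measurable (Pi\<^sub>M (Basis :: 'a set) (\<lambda>b. lborel :: real measure))"
    by measurable
  have eq: "(\<Prod>b\<in>Basis. f b ((\<Sum>b\<in>Basis. g b *\<^sub>R b) \<bullet> b)) = (\<Prod>b\<in>Basis. f b (g b))" for g :: "'a \<Rightarrow> real"
    by (intro prod.cong refl) simp
  show "integral\<^sup>L lborel (\<lambda>x. \<Prod>b\<in>Basis. f b (x \<bullet> b)) = (\<Prod>b\<in>Basis. integral\<^sup>L lborel (f b))"
    by (subst lborel_eq, subst integral_distr[OF m])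
      (simp_all add: eq product_integral_prod assms)
  show "integrable lborel (\<lambda>x. \<Prod>b\<in>Basis. f b (x \<bullet> b))"
    by (subst lborel_eq, subst integrable_distr_eq[OF m])
      (simp_all add: eq product_integrable_prod assms)
qed

text \<open>
  The decay of order \<open>2 d\<close> dominates \<open>f\<close> by a multiple of the product of the functions
  \<open>1 / (1 + x\<^sub>b\<^sup>2)\<close> of the coordinates, each of which is integrable.
\<close>

lemma schwartz_integrable:
  fixes f :: "'a::euclidean_space \<Rightarrow> complex"
  assumes "schwartz f"
  shows "integrable lborel f"
proof -
  define n where "n = DIM('a)"
  have diff: "f differentiable (at x)" for x
    using assms[unfolded schwartz_def, rule_format, of "[]"] by simp
  have bdd: "bounded (range (\<lambda>x. (norm x ^ N) *\<^sub>R f x))" for N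
    using assms[unfolded schwartz_def, rule_format, of "[]"] by simp
  have "continuous_on UNIV f"
    using diff by (intro differentiable_imp_continuous_on) (auto simp: differentiable_on_def)
  then have [measurable]: "f \<in> borel_measurable borel"
    by (rule borel_measurable_continuous_onI)
  obtain B0 where B0: "\<And>x. norm (f x) \<le> B0"
    using bdd[of 0] unfolding bounded_iff by auto
  obtain B1 where B1: "\<And>x. norm x ^ (2 * n) * norm (f x) \<le> B1"
    using bdd[of "2 * n"] unfolding bounded_iff by auto
  define D where "D = 2 ^ n * (B0 + B1)"
  define P where "P = (\<lambda>x::'a. \<Prod>b\<in>Basis. complex_of_real (inverse (1 + (x \<bullet> b)\<^sup>2)))"
  have norm_P: "norm (P x) = inverse (\<Prod>b\<in>Basis. 1 + (x \<bullet> b)\<^sup>2)" for x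
  proof -
    have "(\<Prod>b\<in>Basis. 1 + (x \<bullet> b)\<^sup>2) \<ge> 0" by (intro prod_nonneg) auto
    moreover have "P x = complex_of_real (inverse (\<Prod>b\<in>Basis. 1 + (x \<bullet> b)\<^sup>2))"
      unfolding P_def of_real_prod[symmetric] by (simp only: prod_inversef[symmetric] comp_def)
    ultimately show ?thesis by (simp only: norm_of_real abs_of_nonneg inverse_nonnegative_iff_nonnegative)
  qed
  have "integrable lborel (\<lambda>u::real. inverse (1 + u\<^sup>2))"
    using integrable_inverse_1_plus_square by (simp add: set_integrable_def)
  then have "integrable lborel (\<lambda>u::real. complex_of_real (inverse (1 + u\<^sup>2)))"
    by (rule integrable_of_real)
  then have P: "integrable lborel P"
    unfolding P_def by (intro integral_lborel_prod(2)) auto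
  show ?thesis
  proof (rule Bochner_Integration.integrable_bound)
    show "integrable lborel (\<lambda>x. D *\<^sub>R P x)" using P by simp
    have "norm (f x) \<le> norm (D *\<^sub>R P x)" for x
    proof -
      define s where "s = (norm x)\<^sup>2"
      have "s \<ge> 0" by (simp add: s_def)
      have "(\<Prod>b\<in>Basis. 1 + (x \<bullet> b)\<^sup>2) \<le> (\<Prod>b\<in>(Basis :: 'a set). 1 + s)"
      proof (intro prod_mono conjI)
        fix b :: 'a assume "b \<in> Basis"
        then have "\<bar>x \<bullet> b\<bar>\<^sup>2 \<le> (norm x)\<^sup>2" by (intro power_mono Basis_le_norm) auto
        then show "1 + (x \<bullet> b)\<^sup>2 \<le> 1 + s" by (simp add: s_def)
      qed auto
      also have "\<dots> = (1 + s) ^ n" by (simp add: n_def)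
      also have "\<dots> \<le> (2 * max 1 s) ^ n" using \<open>s \<ge> 0\<close> by (intro power_mono) auto
      also have "\<dots> = 2 ^ n * (max 1 s) ^ n" by (simp add: power_mult_distrib)
      also have "\<dots> \<le> 2 ^ n * (1 + s ^ n)" using \<open>s \<ge> 0\<close> by (intro mult_left_mono) (auto simp: max_def)
      finally have prod_le: "(\<Prod>b\<in>Basis. 1 + (x \<bullet> b)\<^sup>2) \<le> 2 ^ n * (1 + s ^ n)" .
      have pos: "(\<Prod>b\<in>Basis. 1 + (x \<bullet> b)\<^sup>2) > 0"
        by (intro prod_pos) (auto intro: add_pos_nonneg)
      have "norm (f x) * (\<Prod>b\<in>Basis. 1 + (x \<bullet> b)\<^sup>2) \<le> norm (f x) * (2 ^ n * (1 + s ^ n))"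
        by (intro mult_left_mono prod_le) auto
      also have "\<dots> = 2 ^ n * (norm (f x) + norm x ^ (2 * n) * norm (f x))"
        by (simp add: s_def algebra_simps flip: power_mult)
      also have "\<dots> \<le> D"
        unfolding D_def by (intro mult_left_mono add_mono B0 B1) auto
      finally have "norm (f x) \<le> D * norm (P x)"
        unfolding norm_P using pos by (simp add: field_simps)
      also have "\<dots> \<le> norm (D *\<^sub>R P x)" by (simp add: mult_right_mono)
      finally show ?thesis .
    qed
    then show "AE x in lborel. norm (f x) \<le> norm (D *\<^sub>R P x)" by simp
  qed simp
qed

section \<open>The Plancherel inequality\<close>

lemma measurable_cnj [measurable]: "cnj \<in> borel_measurable borel"
  by (intro borel_measurable_continuous_onI continuous_intros)

text \<open>
  Up to the substitution \<open>\<xi> = n x\<close>, this is the characteristic function of the standard normal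
  distribution.
\<close>

lemma integral_gaussian_character_1:
  fixes n u :: real
  assumes "n > 0"
  shows "(\<integral>\<xi>. complex_of_real (exp (- \<xi>\<^sup>2 / (2 * n\<^sup>2))) * cis (- 2 * pi * (u * \<xi>)) \<partial>lborel)
       = complex_of_real (normal_density 0 (1 / (2 * pi * n)) u)"
    and "integrable lborel (\<lambda>\<xi>. complex_of_real (exp (- \<xi>\<^sup>2 / (2 * n\<^sup>2))) * cis (- 2 * pi * (u * \<xi>)))"
proof -
  define F where "F = (\<lambda>\<xi>. complex_of_real (exp (- \<xi>\<^sup>2 / (2 * n\<^sup>2))) * cis (- 2 * pi * (u * \<xi>)))"
  define t where "t = - 2 * pi * u * n"
  have F_scaled: "F (0 + n * x) = of_real (sqrt (2 * pi)) * (std_normal_density x *\<^sub>R iexp (t * x))" for x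
  proof -
    have "- (n * x)\<^sup>2 / (2 * n\<^sup>2) = - x\<^sup>2 / 2"
      using assms by (simp add: power_mult_distrib field_simps)
    then show ?thesis
      by (simp add: F_def t_def std_normal_density_def cis_conv_exp scaleR_conv_of_real mult_ac)
  qed
  have "integrable lborel (\<lambda>x. std_normal_density x *\<^sub>R iexp (t * x))"
    by (rule Bochner_Integration.integrable_bound[OF integrable_normal_density[of 1 0]]) (auto simp: norm_mult)
  then have "integrable lborel (\<lambda>x. F (0 + n * x))"
    unfolding F_scaled by (intro integrable_mult_right)
  then show "integrable lborel (\<lambda>\<xi>. complex_of_real (exp (- \<xi>\<^sup>2 / (2 * n\<^sup>2))) * cis (- 2 * pi * (u * \<xi>)))"
    using assms lborel_integrable_real_affine_iff[of n F 0] unfolding F_def by simp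
  have "integral\<^sup>L lborel F = n *\<^sub>R (of_real (sqrt (2 * pi)) * (\<integral>x. std_normal_density x *\<^sub>R iexp (t * x) \<partial>lborel))"
    using assms by (subst lborel_integral_real_affine[where c=n and t=0]) (simp_all only: F_scaled integral_mult_right_zero, simp)
  also have "(\<integral>x. std_normal_density x *\<^sub>R iexp (t * x) \<partial>lborel) = char std_normal_distribution t"
    unfolding char_def by (subst integral_density) auto
  also have "\<dots> = complex_of_real (exp (- (t\<^sup>2) / 2))"
    by (simp add: char_std_normal_distribution)
  also have "n *\<^sub>R (of_real (sqrt (2 * pi)) * complex_of_real (exp (- (t\<^sup>2) / 2)))
      = complex_of_real (normal_density 0 (1 / (2 * pi * n)) u)"
  proof -
    have "1 / sqrt (2 * pi * (1 / (2 * pi * n))\<^sup>2) = n * sqrt (2 * pi)"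
      using assms by (simp add: real_sqrt_mult real_sqrt_divide power_divide power_mult_distrib field_simps)
    moreover have "- (u - 0)\<^sup>2 / (2 * (1 / (2 * pi * n))\<^sup>2) = - t\<^sup>2 / 2"
      using assms by (simp add: t_def power_divide power_mult_distrib field_simps)
    ultimately show ?thesis
      by (simp only: normal_density_def) (simp add: scaleR_conv_of_real mult_ac)
  qed
  finally show "(\<integral>\<xi>. complex_of_real (exp (- \<xi>\<^sup>2 / (2 * n\<^sup>2))) * cis (- 2 * pi * (u * \<xi>)) \<partial>lborel)
       = complex_of_real (normal_density 0 (1 / (2 * pi * n)) u)"
    unfolding F_def .
qed

lemma norm_integral_le_nn_integral:
  fixes f :: "'a \<Rightarrow> 'b::{banach, second_countable_topology}"
  shows "ennreal (norm (integral\<^sup>L M f)) \<le> (\<integral>\<^sup>+x. ennreal (norm (f x)) \<partial>M)"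
  by (cases "integrable M f") (auto simp: integral_norm_bound_ennreal not_integrable_integral_eq)

text \<open>
  A Gaussian that increases to 1 as \<open>n\<close> grows, and its Fourier transform, an approximate identity: the
  centred normal density with standard deviation \<open>1 / (2 \<pi> n)\<close> in every coordinate.
\<close>

definition gaussian_weight :: "real \<Rightarrow> 'a::euclidean_space \<Rightarrow> real" where
  "gaussian_weight n \<xi> = exp (- (norm \<xi>)\<^sup>2 / (2 * n\<^sup>2))"

definition gaussian_kernel :: "real \<Rightarrow> 'a::euclidean_space \<Rightarrow> real" where
  "gaussian_kernel n x = (\<Prod>b\<in>Basis. normal_density 0 (1 / (2 * pi * n)) (x \<bullet> b))"

lemma measurable_gaussian [measurable]:
  "gaussian_weight n \<in> borel_measurable borel" "gaussian_kernel n \<in> borel_measurable borel"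
  unfolding gaussian_weight_def[abs_def] gaussian_kernel_def[abs_def] by measurable

lemma gaussian_kernel_nonneg: "gaussian_kernel n x \<ge> 0"
  unfolding gaussian_kernel_def by (intro prod_nonneg) auto

lemma gaussian_weight_prod:
  fixes x \<xi> :: "'a::euclidean_space"
  shows "complex_of_real (gaussian_weight n \<xi>) * character x \<xi>
    = (\<Prod>b\<in>Basis. complex_of_real (exp (- (\<xi> \<bullet> b)\<^sup>2 / (2 * n\<^sup>2))) * cis (- 2 * pi * ((x \<bullet> b) * (\<xi> \<bullet> b))))"
proof -
  have "gaussian_weight n \<xi> = (\<Prod>b\<in>Basis. exp (- (\<xi> \<bullet> b)\<^sup>2 / (2 * n\<^sup>2)))"
    unfolding gaussian_weight_def power2_norm_eq_inner euclidean_inner[of \<xi> \<xi>]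
    by (simp add: exp_sum[symmetric] sum_divide_distrib sum_negf power2_eq_square)
  moreover have "character x \<xi> = (\<Prod>b\<in>Basis. cis (- 2 * pi * ((x \<bullet> b) * (\<xi> \<bullet> b))))"
    unfolding character_def euclidean_inner[of x \<xi>] cis_conv_exp
    by (simp add: exp_sum[symmetric] sum_distrib_left sum_negf)
  ultimately show ?thesis
    by (simp only: prod.distrib of_real_prod)
qed

lemma fourier_gaussian:
  fixes x :: "'a::euclidean_space"
  assumes "n > 0"
  shows "(\<integral>\<xi>. complex_of_real (gaussian_weight n \<xi>) * character x \<xi> \<partial>lborel)
       = complex_of_real (gaussian_kernel n x)"
    and "integrable lborel (\<lambda>\<xi>. complex_of_real (gaussian_weight n \<xi>) * character x \<xi>)"
  unfolding gaussian_weight_prod gaussian_kernel_def of_real_prod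
   by (subst integral_lborel_prod, simp_all only: integral_gaussian_character_1[OF assms])
     (rule integral_lborel_prod(2), simp only: integral_gaussian_character_1[OF assms])

lemma integral_gaussian_kernel:
  assumes "n > 0"
  shows "(\<integral>\<^sup>+x. ennreal (gaussian_kernel n (x :: 'a::euclidean_space)) \<partial>lborel) = 1"
proof -
  have "(\<integral>\<^sup>+u. ennreal (normal_density 0 (1 / (2 * pi * n)) u) \<partial>lborel) = 1"
    using assms by (subst nn_integral_eq_integral) auto
  then show ?thesis
    unfolding gaussian_kernel_def
    by (simp add: prod_ennreal[symmetric] del: prod_ennreal)
      (subst nn_integral_lborel_prod, simp_all)
qed

lemma nn_integral_translate:
  fixes f :: "'a::euclidean_space \<Rightarrow> ennreal"
  assumes [measurable]: "f \<in> borel_measurable borel"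
  shows "(\<integral>\<^sup>+x. f (c + x) \<partial>lborel) = (\<integral>\<^sup>+x. f x \<partial>lborel)"
  by (subst (2) lborel_distr_plus[of c, symmetric]) (simp add: nn_integral_distr)

lemma nn_integral_reflect:
  fixes f :: "'a::euclidean_space \<Rightarrow> ennreal"
  assumes [measurable]: "f \<in> borel_measurable borel"
  shows "(\<integral>\<^sup>+x. f (c - x) \<partial>lborel) = (\<integral>\<^sup>+x. f x \<partial>lborel)"
  by (subst (2) lborel_affine[of "-1" c]) (simp_all add: density_1 nn_integral_distr)

text \<open>
  Expanding the square turns the left-hand side into
  \<open>\<integral>\<integral> \<psi>(x) cnj \<psi>(y) k(x - y) dx dy\<close> with the Gaussian kernel \<open>k\<close>. Since \<open>k\<close> is nonnegative with
  integral 1, \<open>|\<psi>(x) \<psi>(y)| \<le> (|\<psi>(x)|\<^sup>2 + |\<psi>(y)|\<^sup>2) / 2\<close> gives the bound. The damping by the Gaussian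
  weight makes all these integrals absolutely convergent.
\<close>

lemma fourier_L2_gaussian_le:
  fixes \<psi> :: "'a::euclidean_space \<Rightarrow> complex"
  assumes \<psi>: "integrable lborel \<psi>" and n: "n > 0"
  shows "(\<integral>\<^sup>+\<xi>. ennreal (gaussian_weight n \<xi> * (norm (fourier \<psi> \<xi>))\<^sup>2) \<partial>lborel)
       \<le> (\<integral>\<^sup>+x. ennreal ((norm (\<psi> x))\<^sup>2) \<partial>lborel)"
proof -
  have [measurable]: "\<psi> \<in> borel_measurable borel"
    using \<psi> by (simp add: borel_measurable_integrable[of lborel, simplified])
  have [measurable]: "fourier \<psi> \<in> borel_measurable borel"
    using measurable_fourier[OF \<psi>, of "\<lambda>x. x"] by simp
  define G where "G = (\<lambda>\<xi>::'a. complex_of_real (gaussian_weight n \<xi>))"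
  have [measurable]: "G \<in> borel_measurable borel" unfolding G_def by measurable
  have G: "integrable lborel G"
    using fourier_gaussian(2)[OF n, of 0] by (simp add: G_def character_def)
  define B where "B = (\<integral>x. norm (\<psi> x) \<partial>lborel)"
  \<comment> \<open>With this choice the damped integral is the integral of \<open>W\<close> against the transform of \<open>\<psi>\<close>.\<close>
  define W where "W = (\<lambda>\<xi>. G \<xi> * cnj (fourier \<psi> \<xi>))"
  have W: "integrable lborel W"
  proof (rule Bochner_Integration.integrable_bound)
    show "integrable lborel (\<lambda>\<xi>. B *\<^sub>R G \<xi>)" using G by simp
    show "AE \<xi> in lborel. norm (W \<xi>) \<le> norm (B *\<^sub>R G \<xi>)"
      using norm_fourier_le[of \<psi>] 
      by (auto simp: W_def B_def norm_mult mult.commute[of "norm (G _)"] intro!: mult_right_mono order.trans[OF _ abs_ge_self])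
  qed (simp add: W_def)
  have W_hat: "fourier W x = (\<integral>y. cnj (\<psi> y) * gaussian_kernel n (x - y) \<partial>lborel)" for x
  proof -
    have "fourier W x = (\<integral>\<xi>. (G \<xi> * character x \<xi>) * (\<integral>y. cnj (\<psi> y) * character (- y) \<xi> \<partial>lborel) \<partial>lborel)"
    proof -
      have "cnj (fourier \<psi> \<xi>) = (\<integral>y. cnj (\<psi> y) * character (- y) \<xi> \<partial>lborel)" for \<xi>
        unfolding fourier_eq_character Bochner_Integration.integral_cnj[symmetric] by (simp add: character_minus del: Bochner_Integration.integral_cnj)
      then show ?thesis
        unfolding fourier_eq_character[of W] unfolding W_def
        by (simp add: character_commute[of _ x] mult_ac)
    qed
    also have "\<dots> = (\<integral>y. cnj (\<psi> y) * fourier (\<lambda>\<xi>. G \<xi> * character x \<xi>) (- y) \<partial>lborel)"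
      by (rule integral_fourier_swap)
        (use \<psi> fourier_gaussian(2)[OF n] in \<open>auto simp: G_def intro: lborel.sigma_finite_measure_axioms\<close>)
    also have "\<dots> = (\<integral>y. cnj (\<psi> y) * gaussian_kernel n (x - y) \<partial>lborel)"
    proof -
      have "fourier (\<lambda>\<xi>. G \<xi> * character x \<xi>) (- y) = gaussian_kernel n (x - y)" for y
        using fourier_gaussian(1)[OF n, of "x - y"] character_add[of x "- y"]
        by (simp add: fourier_eq_character G_def character_commute[of _ "- y"] mult.assoc)
      then show ?thesis by simp
    qed
    finally show ?thesis .
  qed
  have "(\<integral>\<^sup>+\<xi>. ennreal (gaussian_weight n \<xi> * (norm (fourier \<psi> \<xi>))\<^sup>2) \<partial>lborel)
      = ennreal (\<integral>\<xi>. gaussian_weight n \<xi> * (norm (fourier \<psi> \<xi>))\<^sup>2 \<partial>lborel)"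
  proof (rule nn_integral_eq_integral)
    have "integrable lborel (\<lambda>\<xi>. fourier \<psi> \<xi> * W \<xi>)"
    proof (rule Bochner_Integration.integrable_bound)
      show "integrable lborel (\<lambda>\<xi>. B *\<^sub>R W \<xi>)" using W by simp
      show "AE \<xi> in lborel. norm (fourier \<psi> \<xi> * W \<xi>) \<le> norm (B *\<^sub>R W \<xi>)"
        using norm_fourier_le[of \<psi>] 
        by (auto simp: B_def norm_mult intro!: mult_right_mono order.trans[OF _ abs_ge_self])
    qed (simp add: W_def)
    moreover have "norm (fourier \<psi> \<xi> * W \<xi>) = gaussian_weight n \<xi> * (norm (fourier \<psi> \<xi>))\<^sup>2" for \<xi>
      by (simp add: W_def G_def norm_mult power2_eq_square gaussian_weight_def)
    ultimately show "integrable lborel (\<lambda>\<xi>. gaussian_weight n \<xi> * (norm (fourier \<psi> \<xi>))\<^sup>2)"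
      using integrable_norm by fastforce
  qed (auto simp: gaussian_weight_def)
  also have "\<dots> = ennreal (norm (\<integral>\<xi>. W \<xi> * fourier \<psi> \<xi> \<partial>lborel))"
  proof -
    have "W \<xi> * fourier \<psi> \<xi> = complex_of_real (gaussian_weight n \<xi> * (norm (fourier \<psi> \<xi>))\<^sup>2)" for \<xi>
      by (simp add: W_def G_def complex_norm_square mult_ac del: of_real_power)
    then show ?thesis
      by (simp only: integral_complex_of_real norm_of_real)
        (simp add: gaussian_weight_def abs_of_nonneg[OF Bochner_Integration.integral_nonneg])
  qed
  also have "(\<integral>\<xi>. W \<xi> * fourier \<psi> \<xi> \<partial>lborel) = (\<integral>x. \<psi> x * fourier W x \<partial>lborel)"
    by (subst integral_fourier_swap[symmetric, where \<phi>="\<lambda>x. x"])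
      (use W \<psi> in \<open>auto simp: fourier_eq_character[of W] character_commute intro: lborel.sigma_finite_measure_axioms\<close>)
  also have "ennreal (norm \<dots>) \<le> (\<integral>\<^sup>+x. ennreal (norm (\<psi> x * fourier W x)) \<partial>lborel)"
    by (rule norm_integral_le_nn_integral)
  also have "(\<integral>\<^sup>+x. ennreal (norm (\<psi> x * fourier W x)) \<partial>lborel)
      \<le> (\<integral>\<^sup>+x. (\<integral>\<^sup>+y. ennreal (norm (\<psi> x) * norm (\<psi> y) * gaussian_kernel n (x - y)) \<partial>lborel) \<partial>lborel)"
  proof (rule nn_integral_mono)
    fix x
    have "ennreal (norm (\<psi> x * fourier W x)) = norm (\<psi> x) * ennreal (norm (fourier W x))"
      by (simp add: norm_mult ennreal_mult)
    also have "\<dots> \<le> norm (\<psi> x) * (\<integral>\<^sup>+y. ennreal (norm (cnj (\<psi> y) * gaussian_kernel n (x - y))) \<partial>lborel)"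
      unfolding W_hat by (intro mult_left_mono norm_integral_le_nn_integral) auto
    also have "\<dots> = (\<integral>\<^sup>+y. ennreal (norm (\<psi> x) * norm (\<psi> y) * gaussian_kernel n (x - y)) \<partial>lborel)"
      by (subst nn_integral_cmult[symmetric])
        (auto simp: norm_mult gaussian_kernel_nonneg mult.assoc simp flip: ennreal_mult)
    finally show "ennreal (norm (\<psi> x * fourier W x)) \<le> \<dots>" .
  qed
  also have "\<dots> \<le> (\<integral>\<^sup>+x. (\<integral>\<^sup>+y. ennreal ((norm (\<psi> x))\<^sup>2 / 2) * ennreal (gaussian_kernel n (x - y))
      + ennreal ((norm (\<psi> y))\<^sup>2 / 2) * ennreal (gaussian_kernel n (x - y)) \<partial>lborel) \<partial>lborel)"
  proof (intro nn_integral_mono)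
    fix x y
    have "norm (\<psi> x) * norm (\<psi> y) \<le> (norm (\<psi> x))\<^sup>2 / 2 + (norm (\<psi> y))\<^sup>2 / 2"
      using sum_squares_bound[of "norm (\<psi> x)" "norm (\<psi> y)"] by (simp add: field_simps)
    from mult_right_mono[OF this gaussian_kernel_nonneg[of n "x - y"]]
    show "ennreal (norm (\<psi> x) * norm (\<psi> y) * gaussian_kernel n (x - y))
      \<le> ennreal ((norm (\<psi> x))\<^sup>2 / 2) * ennreal (gaussian_kernel n (x - y))
      + ennreal ((norm (\<psi> y))\<^sup>2 / 2) * ennreal (gaussian_kernel n (x - y))"
      by (simp add: gaussian_kernel_nonneg ring_distribs flip: ennreal_mult ennreal_plus)
  qed
  also have "\<dots> = (\<integral>\<^sup>+x. (\<integral>\<^sup>+y. ennreal ((norm (\<psi> x))\<^sup>2 / 2) * ennreal (gaussian_kernel n (x - y)) \<partial>lborel) \<partial>lborel)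
     + (\<integral>\<^sup>+y. (\<integral>\<^sup>+x. ennreal ((norm (\<psi> y))\<^sup>2 / 2) * ennreal (gaussian_kernel n (x - y)) \<partial>lborel) \<partial>lborel)"
    by (subst nn_integral_add, measurable, subst nn_integral_add, measurable)
      (subst (2) lborel_pair.Fubini', simp_all)
  also have "\<dots> = (\<integral>\<^sup>+x. ennreal ((norm (\<psi> x))\<^sup>2 / 2) \<partial>lborel) + (\<integral>\<^sup>+x. ennreal ((norm (\<psi> x))\<^sup>2 / 2) \<partial>lborel)"
  proof -
    have "(\<integral>\<^sup>+y. ennreal (gaussian_kernel n (x - y)) \<partial>lborel) = 1" for x :: 'a
      by (subst nn_integral_reflect[of "\<lambda>y. ennreal (gaussian_kernel n y)"])
        (simp_all add: integral_gaussian_kernel[OF n])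
    moreover have "(\<integral>\<^sup>+x. ennreal (gaussian_kernel n (x - y)) \<partial>lborel) = 1" for y :: 'a
      using nn_integral_translate[of "\<lambda>y. ennreal (gaussian_kernel n y)" "- y"]
      by (simp add: integral_gaussian_kernel[OF n])
    ultimately show ?thesis
      by (simp add: nn_integral_cmult)
  qed
  also have "\<dots> = (\<integral>\<^sup>+x. ennreal ((norm (\<psi> x))\<^sup>2) \<partial>lborel)"
    by (subst nn_integral_add[symmetric]) (simp_all flip: ennreal_plus)
  finally show ?thesis .
qed

text \<open>
  One half of Plancherel's theorem: the damping in the previous lemma is removed by Fatou's lemma.
\<close>

theorem fourier_L2_le:
  fixes \<psi> :: "'a::euclidean_space \<Rightarrow> complex"
  assumes \<psi>: "integrable lborel \<psi>"
  shows "(\<integral>\<^sup>+\<xi>. ennreal ((norm (fourier \<psi> \<xi>))\<^sup>2) \<partial>lborel) \<le> (\<integral>\<^sup>+x. ennreal ((norm (\<psi> x))\<^sup>2) \<partial>lborel)"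
proof -
  have [measurable]: "fourier \<psi> \<in> borel_measurable borel"
    using measurable_fourier[OF \<psi>, of "\<lambda>x. x"] by simp
  have lim: "(\<lambda>n. ennreal (gaussian_weight (real (Suc n)) \<xi> * (norm (fourier \<psi> \<xi>))\<^sup>2))
      \<longlonglongrightarrow> ennreal ((norm (fourier \<psi> \<xi>))\<^sup>2)" for \<xi>
  proof (rule tendsto_ennrealI)
    have "(\<lambda>n. gaussian_weight (real (Suc n)) \<xi>) \<longlonglongrightarrow> 1"
      unfolding gaussian_weight_def by real_asymp
    from tendsto_mult_right[OF this]
    show "(\<lambda>n. gaussian_weight (real (Suc n)) \<xi> * (norm (fourier \<psi> \<xi>))\<^sup>2) \<longlonglongrightarrow> (norm (fourier \<psi> \<xi>))\<^sup>2"
      by simp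
  qed
  have "(\<integral>\<^sup>+\<xi>. ennreal ((norm (fourier \<psi> \<xi>))\<^sup>2) \<partial>lborel)
      = (\<integral>\<^sup>+\<xi>. liminf (\<lambda>n. ennreal (gaussian_weight (real (Suc n)) \<xi> * (norm (fourier \<psi> \<xi>))\<^sup>2)) \<partial>lborel)"
    by (simp only: lim_imp_Liminf[OF trivial_limit_sequentially lim])
  also have "\<dots> \<le> liminf (\<lambda>n. \<integral>\<^sup>+\<xi>. ennreal (gaussian_weight (real (Suc n)) \<xi> * (norm (fourier \<psi> \<xi>))\<^sup>2) \<partial>lborel)"
    by (rule nn_integral_liminf) simp
  also have "\<dots> \<le> limsup (\<lambda>n. \<integral>\<^sup>+\<xi>. ennreal (gaussian_weight (real (Suc n)) \<xi> * (norm (fourier \<psi> \<xi>))\<^sup>2) \<partial>lborel)"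
    by (rule Liminf_le_Limsup) simp
  also have "\<dots> \<le> (\<integral>\<^sup>+x. ennreal ((norm (\<psi> x))\<^sup>2) \<partial>lborel)"
    by (intro Limsup_bounded always_eventually allI fourier_L2_gaussian_le[OF \<psi>]) simp
  finally show ?thesis .
qed

section \<open>Surface measure on orthants of the sphere\<close>

lemma nn_integral_lborel_scale:
  fixes f :: "'a::euclidean_space \<Rightarrow> ennreal"
  assumes [measurable]: "f \<in> borel_measurable borel" and "r > 0"
  shows "(\<integral>\<^sup>+x. f x \<partial>lborel) = ennreal (r ^ DIM('a)) * (\<integral>\<^sup>+x. f (r *\<^sub>R x) \<partial>lborel)"
  using assms(2)
  by (subst lborel_affine[of r 0]) (simp_all add: nn_integral_density nn_integral_distr nn_integral_cmult)

lemma measurable_ident_sphere_measure: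
  "(\<lambda>x. x) \<in> borel_measurable (sphere_measure :: 'a::euclidean_space measure)"
proof -
  have "sets (sphere_measure :: 'a measure) = sets (restrict_space borel (sphere 0 1))"
    by (simp add: sphere_measure_def sets_scale_measure)
  then show ?thesis
    by (subst measurable_cong_sets[OF _ refl]) (auto intro!: measurable_restrict_space1)
qed

lemma nn_integral_sphere_measure:
  fixes F :: "'a::euclidean_space \<Rightarrow> ennreal"
  assumes [measurable]: "F \<in> borel_measurable borel"
  shows "(\<integral>\<^sup>+x. F x \<partial>sphere_measure) =
    of_nat DIM('a) * (\<integral>\<^sup>+x. F (sgn x) * indicator {x. norm x \<le> 1} x \<partial>lborel)"
proof -
  have F: "F \<in> borel_measurable (restrict_space borel (sphere 0 1))"
    by (intro measurable_restrict_space1) simp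
  have "(\<integral>\<^sup>+x. F x \<partial>sphere_measure) = of_nat DIM('a) *
     (\<integral>\<^sup>+x. F x \<partial>distr (restrict_space lborel (cball 0 1 - {0})) (restrict_space borel (sphere 0 1)) sgn)"
    unfolding sphere_measure_def using F by (subst nn_integral_scale_measure) auto
  also have "(\<integral>\<^sup>+x. F x \<partial>distr (restrict_space lborel (cball 0 1 - {0})) (restrict_space borel (sphere 0 1)) sgn)
     = (\<integral>\<^sup>+x. F (sgn x) * indicator (cball 0 1 - {0}) x \<partial>lborel)"
    by (subst nn_integral_distr[OF sgn_measurable_sphere], simp add: F,
        subst nn_integral_restrict_space) auto
  also have "\<dots> = (\<integral>\<^sup>+x. F (sgn x) * indicator {x. norm x \<le> 1} x \<partial>lborel)"
    by (intro nn_integral_cong_AE eventually_mono[OF AE_lborel_singleton[of 0]])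
      (auto split: split_indicator)
  finally show ?thesis .
qed

text \<open>
  The function \<open>F (sgn x)\<close> is constant on rays, so its integral over a ball scales like the volume
  of the ball. The shell therefore carries the fraction \<open>1 - (1 - \<delta>)\<^sup>d \<ge> \<delta>\<close> of the integral over the
  unit ball, which defines the surface measure. Finiteness allows the inner ball to be subtracted.
\<close>

lemma sphere_integral_le_shell:
  fixes F :: "'a::euclidean_space \<Rightarrow> ennreal"
  assumes [measurable]: "F \<in> borel_measurable borel" and \<delta>: "0 < \<delta>" "\<delta> < 1"
    and fin: "(\<integral>\<^sup>+x. F x \<partial>sphere_measure) < \<infinity>"
  shows "ennreal \<delta> * (\<integral>\<^sup>+x. F x \<partial>sphere_measure)
    \<le> of_nat DIM('a) * (\<integral>\<^sup>+x. F (sgn x) * indicator {x. 1 - \<delta> < norm x \<and> norm x \<le> 1} x \<partial>lborel)"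
proof -
  define I where "I = (\<integral>\<^sup>+x. F (sgn x) * indicator {x::'a. norm x \<le> 1} x \<partial>lborel)"
  define S where "S = (\<integral>\<^sup>+x. F (sgn x) * indicator {x::'a. 1 - \<delta> < norm x \<and> norm x \<le> 1} x \<partial>lborel)"
  have I_fin: "I < \<infinity>"
    using fin unfolding nn_integral_sphere_measure[OF assms(1)] I_def
    by (auto simp: ennreal_mult_less_top)
  have small: "(\<integral>\<^sup>+x. F (sgn x) * indicator {x::'a. norm x \<le> 1 - \<delta>} x \<partial>lborel)
      = ennreal ((1 - \<delta>) ^ DIM('a)) * I"
    unfolding I_def using \<delta>
    by (subst nn_integral_lborel_scale[of _ "1 - \<delta>"])
      (auto intro!: arg_cong2[where f="(*)"] nn_integral_cong simp: sgn_scaleR split: split_indicator)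
  have "I = (\<integral>\<^sup>+x. F (sgn x) * indicator {x::'a. norm x \<le> 1 - \<delta>} x
      + F (sgn x) * indicator {x::'a. 1 - \<delta> < norm x \<and> norm x \<le> 1} x \<partial>lborel)"
    unfolding I_def using \<delta> by (intro nn_integral_cong) (auto split: split_indicator)
  also have "\<dots> = ennreal ((1 - \<delta>) ^ DIM('a)) * I + S"
    unfolding small[symmetric] S_def by (rule nn_integral_add) auto
  also have "\<dots> \<le> ennreal (1 - \<delta>) * I + S"
    using \<delta> power_decreasing[of 1 "DIM('a)" "1 - \<delta>"]
    by (intro add_right_mono mult_right_mono ennreal_leI) (auto simp: Suc_le_eq)
  finally have "I \<le> ennreal (1 - \<delta>) * I + S" .
  moreover have "I = ennreal (1 - \<delta>) * I + ennreal \<delta> * I"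
    using \<delta> by (simp flip: distrib_right ennreal_plus)
  ultimately have "ennreal (1 - \<delta>) * I + ennreal \<delta> * I \<le> ennreal (1 - \<delta>) * I + S" by simp
  then have "ennreal \<delta> * I \<le> S"
    using I_fin by (auto simp: ennreal_add_left_cancel_le ennreal_mult_eq_top_iff)
  then have "of_nat DIM('a) * (ennreal \<delta> * I) \<le> of_nat DIM('a) * S"
    by (intro mult_left_mono) auto
  then show ?thesis
    unfolding nn_integral_sphere_measure[OF assms(1)] I_def S_def
    by (simp only: mult.left_commute)
qed

text \<open>
  The orthants are half-open, so that they partition the space; \<open>J\<close> collects the coordinates that
  are nonnegative.
\<close>

definition orthant :: "'a::euclidean_space set \<Rightarrow> 'a set" where
  "orthant J = {x. \<forall>b\<in>Basis. 0 \<le> x \<bullet> b \<longleftrightarrow> b \<in> J}"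

lemma orthant_borel [measurable]: "orthant J \<in> sets borel"
  unfolding orthant_def by measurable

lemma orthant_cover: "\<exists>!J. J \<in> Pow Basis \<and> x \<in> orthant J"
  by (rule ex1I[of _ "{b\<in>Basis. 0 \<le> x \<bullet> b}"]) (auto simp: orthant_def)

lemma orthant_inner_nonneg:
  assumes "x \<in> orthant J" "y \<in> orthant J"
  shows "x \<bullet> y \<ge> 0"
  unfolding euclidean_inner[of x y]
proof (rule sum_nonneg)
  fix b :: 'a assume b: "b \<in> Basis"
  show "(x \<bullet> b) * (y \<bullet> b) \<ge> 0"
  proof (cases "b \<in> J")
    case True
    then show ?thesis using assms b by (auto simp: orthant_def)
  next
    case False
    then have "x \<bullet> b < 0" "y \<bullet> b < 0" using assms b unfolding orthant_def by force+
    then show ?thesis by (simp add: mult_nonpos_nonpos)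
  qed
qed

lemma orthant_sgn:
  assumes "x \<noteq> 0"
  shows "sgn x \<in> orthant J \<longleftrightarrow> x \<in> orthant J"
proof -
  have "0 \<le> sgn x \<bullet> b \<longleftrightarrow> 0 \<le> x \<bullet> b" for b
    using assms by (simp add: sgn_div_norm zero_le_mult_iff)
  then show ?thesis by (simp add: orthant_def)
qed

text \<open>
  Surface measure of one orthant of the sphere, regarded as a Borel measure on the whole space so
  that it can be convolved.
\<close>

definition orthant_measure :: "'a::euclidean_space set \<Rightarrow> 'a measure" where
  "orthant_measure J = density (distr sphere_measure borel (\<lambda>x. x)) (indicator (orthant J))"

lemma sets_orthant_measure [simp, measurable_cong]: "sets (orthant_measure J) = sets borel"
  by (simp add: orthant_measure_def)

lemma space_orthant_measure [simp]: "space (orthant_measure J) = UNIV"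
  by (simp add: orthant_measure_def)

lemma nn_integral_orthant_measure:
  assumes [measurable]: "F \<in> borel_measurable borel"
  shows "(\<integral>\<^sup>+x. F x \<partial>orthant_measure J) = (\<integral>\<^sup>+x. F x * indicator (orthant J) x \<partial>sphere_measure)"
  unfolding orthant_measure_def using measurable_ident_sphere_measure
  by (subst nn_integral_density, simp, simp, subst nn_integral_distr) (simp_all add: mult.commute)

lemma nn_integral_sphere_orthants:
  fixes F :: "'a::euclidean_space \<Rightarrow> ennreal"
  assumes [measurable]: "F \<in> borel_measurable borel"
  shows "(\<integral>\<^sup>+x. F x \<partial>sphere_measure) = (\<Sum>J\<in>Pow Basis. \<integral>\<^sup>+x. F x \<partial>orthant_measure J)"
proof -
  note [measurable] = measurable_ident_sphere_measure
  have "(\<Sum>J\<in>Pow Basis. indicator (orthant J) x) = (1 :: ennreal)" for x :: 'a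
  proof -
    obtain J where J: "J \<in> Pow Basis" "\<And>J'. J' \<in> Pow Basis \<Longrightarrow> x \<in> orthant J' \<longleftrightarrow> J' = J"
      using orthant_cover[of x] by metis
    have "(\<Sum>J\<in>Pow Basis. indicator (orthant J) x) = (\<Sum>J'\<in>Pow Basis. if J' = J then 1 else (0 :: ennreal))"
      by (intro sum.cong refl) (simp only: indicator_def J(2) of_bool_def)
    also have "\<dots> = 1" using J(1) by simp
    finally show ?thesis .
  qed
  then have "(\<integral>\<^sup>+x. F x \<partial>sphere_measure) = (\<integral>\<^sup>+x. (\<Sum>J\<in>Pow Basis. F x * indicator (orthant J) x) \<partial>sphere_measure)"
    by (simp add: sum_distrib_left[symmetric])
  also have "\<dots> = (\<Sum>J\<in>Pow Basis. \<integral>\<^sup>+x. F x \<partial>orthant_measure J)"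
    by (subst nn_integral_sum) (simp_all add: nn_integral_orthant_measure)
  finally show ?thesis .
qed

lemma emeasure_orthant_measure_le:
  "emeasure (orthant_measure J) UNIV \<le> ennreal (4 * pi)" for J :: "(real^3) set"
proof -
  have sp: "space (sphere_measure :: (real^3) measure) = sphere 0 1"
    by (simp add: sphere_measure_def space_scale_measure space_restrict_space)
  have "emeasure (orthant_measure J) UNIV = (\<integral>\<^sup>+x. 1 * indicator (orthant J) x \<partial>sphere_measure)"
    by (subst nn_integral_orthant_measure[symmetric]) simp_all
  also have "\<dots> \<le> (\<integral>\<^sup>+x. 1 \<partial>(sphere_measure :: (real^3) measure))"
    by (intro nn_integral_mono) (simp split: split_indicator)
  also have "\<dots> = ennreal (4 * pi)"
    using emeasure_sphere_measure_S2 by (simp add: sp)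
  finally show ?thesis .
qed

lemma finite_orthant_measure: "finite_measure (orthant_measure J)" for J :: "(real^3) set"
  using emeasure_orthant_measure_le[of J]
  by (intro finite_measureI) (auto simp: space_orthant_measure top_unique)

section \<open>Sums of two points of one orthant\<close>

text \<open>
  Three-dimensional space is sliced along the first axis, and the slices are identified with the
  complex plane, where the area of a disc is known.
\<close>

lemma measurable_slice_map:
  "(\<lambda>(s, c). vector [s, Re c, Im c] :: real^3) \<in> lborel \<Otimes>\<^sub>M lborel \<rightarrow>\<^sub>M borel"
proof -
  define T where "T = (\<lambda>(s, c). vector [s, Re c, Im c] :: real^3)"
  have T_eq: "T p = fst p *\<^sub>R axis 1 1 + Re (snd p) *\<^sub>R axis 2 1 + Im (snd p) *\<^sub>R axis 3 1" for p
    by (auto simp: T_def vec_eq_iff forall_3 axis_def split: prod.split)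
  have "T \<in> borel \<rightarrow>\<^sub>M borel"
    unfolding T_eq[abs_def] by (intro borel_measurable_continuous_onI continuous_intros)
  then show ?thesis by (simp add: lborel_prod T_def)
qed

lemma lborel_real3_eq_distr:
  "(lborel :: (real^3) measure)
    = distr (lborel \<Otimes>\<^sub>M lborel) borel (\<lambda>(s, c). vector [s, Re c, Im c])"
proof (rule lborel_eqI)
  define T where "T = (\<lambda>(s, c). vector [s, Re c, Im c] :: real^3)"
  have T[measurable]: "T \<in> lborel \<Otimes>\<^sub>M lborel \<rightarrow>\<^sub>M borel"
    unfolding T_def by (rule measurable_slice_map)
  fix l u :: "real^3" assume le: "\<And>b. b \<in> Basis \<Longrightarrow> l \<bullet> b \<le> u \<bullet> b"
  have le': "l $ i \<le> u $ i" for i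
    using le[of "axis i 1"] by (simp add: axis_in_Basis_iff inner_axis)
  have pre: "T -` box l u = box (l $ 1) (u $ 1) \<times> box (Complex (l $ 2) (l $ 3)) (Complex (u $ 2) (u $ 3))"
    by (auto simp: T_def mem_box_cart forall_3 in_box_complex_iff)
  have "emeasure (distr (lborel \<Otimes>\<^sub>M lborel) borel T) (box l u)
      = emeasure (lborel \<Otimes>\<^sub>M lborel) (box (l $ 1) (u $ 1) \<times> box (Complex (l $ 2) (l $ 3)) (Complex (u $ 2) (u $ 3)))"
    by (subst emeasure_distr[OF T]) (simp_all add: pre space_pair_measure)
  also have "\<dots> = ennreal (u $ 1 - l $ 1) * ennreal ((u $ 2 - l $ 2) * (u $ 3 - l $ 3))"
    using le' by (subst lborel.emeasure_pair_measure_Times)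
      (auto simp: emeasure_lborel_box_eq Basis_complex_def intro!: arg_cong2[where f="(*)"])
  also have "\<dots> = ennreal ((u $ 1 - l $ 1) * ((u $ 2 - l $ 2) * (u $ 3 - l $ 3)))"
    using le' by (simp add: ennreal_mult)
  also have "\<dots> = ennreal (\<Prod>b\<in>Basis. (u - l) \<bullet> b)"
  proof -
    have "(\<Prod>b\<in>Basis. (u - l) \<bullet> b) = (\<Prod>i\<in>UNIV. (u - l) $ i)"
      unfolding Basis_vec_def
      by (subst prod.UNION_disjoint) (auto simp: axis_eq_axis inner_axis)
    also have "\<dots> = (u $ 1 - l $ 1) * ((u $ 2 - l $ 2) * (u $ 3 - l $ 3))"
    proof -
      have "prod f UNIV = f 1 * (f 2 * f 3)" for f :: "3 \<Rightarrow> real"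
        unfolding UNIV_3 by simp
      then show ?thesis by simp
    qed
    finally show ?thesis by simp
  qed
  finally show "emeasure (distr (lborel \<Otimes>\<^sub>M lborel) borel (\<lambda>(s, c). vector [s, Re c, Im c])) (box l u)
      = ennreal (\<Prod>b\<in>Basis. (u - l) \<bullet> b)"
    unfolding T_def .
qed simp

text \<open>
  The area of a plane annulus is \<open>\<pi>\<close> times the difference of the squared radii. For \<open>A < 2 \<delta>\<close> the set
  is a full disc of area \<open>\<pi> A\<close>, or empty if \<open>A < 0\<close>.
\<close>

lemma emeasure_annulus_le:
  assumes "\<delta> \<ge> 0"
  shows "emeasure lborel {c :: complex. A - 2 * \<delta> < (norm c)\<^sup>2 \<and> (norm c)\<^sup>2 \<le> A} \<le> ennreal (2 * pi * \<delta>)"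
proof -
  have disc: "emeasure lborel {c :: complex. (norm c)\<^sup>2 \<le> B} = ennreal (pi * B)" if "B \<ge> 0" for B
  proof -
    have "(norm c)\<^sup>2 \<le> B \<longleftrightarrow> norm c \<le> sqrt B" for c :: complex
      using real_sqrt_le_iff[of "(norm c)\<^sup>2" B] by (simp only: real_sqrt_abs abs_norm_cancel)
    then have "{c :: complex. (norm c)\<^sup>2 \<le> B} = cball 0 (sqrt B)"
      by (simp add: set_eq_iff)
    then show ?thesis using that by (simp add: emeasure_cball eval_unit_ball_vol)
  qed
  consider "A < 0" | "A \<ge> 0" "A < 2 * \<delta>" | "A \<ge> 2 * \<delta>" by linarith
  then show ?thesis
  proof cases
    case 1
    then have "\<not> (norm c)\<^sup>2 \<le> A" for c :: complex
      using zero_le_power2[of "norm c"] by linarith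
    then show ?thesis by simp
  next
    case 2
    have "emeasure lborel {c :: complex. A - 2 * \<delta> < (norm c)\<^sup>2 \<and> (norm c)\<^sup>2 \<le> A}
        \<le> emeasure lborel {c :: complex. (norm c)\<^sup>2 \<le> A}"
      by (intro emeasure_mono) auto
    also have "\<dots> \<le> ennreal (2 * pi * \<delta>)"
      using 2 by (simp add: disc)
    finally show ?thesis .
  next
    case 3
    have "{c :: complex. A - 2 * \<delta> < (norm c)\<^sup>2 \<and> (norm c)\<^sup>2 \<le> A}
        = {c. (norm c)\<^sup>2 \<le> A} - {c. (norm c)\<^sup>2 \<le> A - 2 * \<delta>}"
      by auto
    also have "emeasure lborel \<dots> = ennreal (pi * A) - ennreal (pi * (A - 2 * \<delta>))"
      using 3 assms by (subst emeasure_Diff) (auto simp: disc)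
    also have "\<dots> = ennreal (2 * pi * \<delta>)"
      using 3 assms by (subst ennreal_minus) (auto simp: algebra_simps)
    finally show ?thesis by simp
  qed
qed

definition shell_intersection :: "real \<Rightarrow> 'a::euclidean_space \<Rightarrow> 'a set" where
  "shell_intersection \<delta> z = {x. 1 - \<delta> < norm x \<and> norm x \<le> 1 \<and> 1 - \<delta> < norm (z - x) \<and> norm (z - x) \<le> 1}"

lemma shell_intersection_borel [measurable]: "shell_intersection \<delta> z \<in> sets borel"
  unfolding shell_intersection_def by measurable

text \<open>
  If \<open>x\<close> lies in both shells, then \<open>2 x \<bullet> z - |z|\<^sup>2 = |x|\<^sup>2 - |z - x|\<^sup>2\<close> is at most \<open>2 \<delta>\<close> in absolute
  value, which confines the first coordinate to an interval of length \<open>4 \<delta>\<close>. In each slice the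
  condition on \<open>|x|\<^sup>2\<close> leaves an annulus of area at most \<open>2 \<pi> \<delta>\<close>.
\<close>

lemma emeasure_shell_intersection_axis_le:
  assumes \<delta>: "0 < \<delta>" "\<delta> \<le> 1" and \<rho>: "\<rho> \<ge> 1 / 2"
  shows "emeasure lborel (shell_intersection \<delta> (axis 1 \<rho> :: real^3)) \<le> ennreal (8 * pi * \<delta>\<^sup>2)"
proof -
  define T where "T = (\<lambda>(s, c). vector [s, Re c, Im c] :: real^3)"
  define S where "S = shell_intersection \<delta> (axis 1 \<rho> :: real^3)"
  have T: "T \<in> lborel \<Otimes>\<^sub>M lborel \<rightarrow>\<^sub>M borel"
    unfolding T_def by (rule measurable_slice_map)
  have slab: "s \<in> {\<rho> / 2 - 2 * \<delta> .. \<rho> / 2 + 2 * \<delta>}"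
    and annulus: "c \<in> {c. (1 - s\<^sup>2) - 2 * \<delta> < (norm c)\<^sup>2 \<and> (norm c)\<^sup>2 \<le> 1 - s\<^sup>2}"
    if "T (s, c) \<in> S" for s c
  proof -
    have n1: "(norm (T (s, c)))\<^sup>2 = s\<^sup>2 + (norm c)\<^sup>2"
      unfolding power2_norm_eq_inner[of "T (s, c)"] cmod_power2
      by (simp add: T_def inner_vec_def sum_3 power2_eq_square)
    have n2: "(norm (axis 1 \<rho> - T (s, c)))\<^sup>2 = (\<rho> - s)\<^sup>2 + (norm c)\<^sup>2"
      unfolding power2_norm_eq_inner[of "axis 1 \<rho> - T (s, c)"] cmod_power2
      by (simp add: T_def inner_vec_def sum_3 power2_eq_square axis_def)
    have bound: "1 - 2 * \<delta> < r\<^sup>2 \<and> r\<^sup>2 \<le> 1" if "1 - \<delta> < r" "r \<le> 1" for r :: real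
    proof
      have "(1 - \<delta>)\<^sup>2 < r\<^sup>2" using that \<delta> by (intro power_strict_mono) auto
      then show "1 - 2 * \<delta> < r\<^sup>2" by (simp add: power2_diff) (smt (verit) zero_le_power2)
      show "r\<^sup>2 \<le> 1" using that \<delta> by (simp add: power_le_one)
    qed
    have b1: "1 - 2 * \<delta> < s\<^sup>2 + (norm c)\<^sup>2 \<and> s\<^sup>2 + (norm c)\<^sup>2 \<le> 1"
      using that bound[of "norm (T (s, c))"] unfolding n1 S_def shell_intersection_def by auto
    have b2: "1 - 2 * \<delta> < (\<rho> - s)\<^sup>2 + (norm c)\<^sup>2 \<and> (\<rho> - s)\<^sup>2 + (norm c)\<^sup>2 \<le> 1"
      using that bound[of "norm (axis 1 \<rho> - T (s, c))"] unfolding n2 S_def shell_intersection_def by auto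
    show "c \<in> {c. (1 - s\<^sup>2) - 2 * \<delta> < (norm c)\<^sup>2 \<and> (norm c)\<^sup>2 \<le> 1 - s\<^sup>2}"
      using b1 by auto
    have "\<bar>\<rho> * (2 * s - \<rho>)\<bar> \<le> 2 * \<delta>"
    proof -
      have "\<rho> * (2 * s - \<rho>) = s\<^sup>2 - (\<rho> - s)\<^sup>2" by (simp add: power2_eq_square algebra_simps)
      then show ?thesis using b1 b2 by linarith
    qed
    then have "\<bar>2 * s - \<rho>\<bar> * (1 / 2) \<le> 2 * \<delta>"
      using mult_left_mono[OF \<rho>, of "\<bar>2 * s - \<rho>\<bar>"] \<rho> by (simp add: abs_mult mult.commute)
    then show "s \<in> {\<rho> / 2 - 2 * \<delta> .. \<rho> / 2 + 2 * \<delta>}" by (auto simp: abs_le_iff)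
  qed
  have "emeasure lborel S = emeasure (lborel \<Otimes>\<^sub>M lborel) (T -` S)"
    unfolding lborel_real3_eq_distr T_def[symmetric]
    by (subst emeasure_distr[OF T]) (auto simp: S_def space_pair_measure)
  also have "\<dots> = (\<integral>\<^sup>+s. emeasure lborel (Pair s -` (T -` S)) \<partial>lborel)"
    using measurable_sets[OF T, of S] 
    by (intro lborel.emeasure_pair_measure_alt) (auto simp: S_def space_pair_measure)
  also have "\<dots> \<le> (\<integral>\<^sup>+s. ennreal (2 * pi * \<delta>) * indicator {\<rho> / 2 - 2 * \<delta> .. \<rho> / 2 + 2 * \<delta>} s \<partial>lborel)"
  proof (rule nn_integral_mono)
    fix s :: real
    show "emeasure lborel (Pair s -` (T -` S)) \<le> ennreal (2 * pi * \<delta>) * indicator {\<rho> / 2 - 2 * \<delta> .. \<rho> / 2 + 2 * \<delta>} s"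
    proof (cases "s \<in> {\<rho> / 2 - 2 * \<delta> .. \<rho> / 2 + 2 * \<delta>}")
      case True
      have "emeasure lborel (Pair s -` (T -` S))
          \<le> emeasure lborel {c :: complex. (1 - s\<^sup>2) - 2 * \<delta> < (norm c)\<^sup>2 \<and> (norm c)\<^sup>2 \<le> 1 - s\<^sup>2}"
        using annulus by (intro emeasure_mono) auto
      also have "\<dots> \<le> ennreal (2 * pi * \<delta>)"
        using \<delta> by (intro emeasure_annulus_le) auto
      finally show ?thesis using True by simp
    next
      case False
      then have "Pair s -` (T -` S) = {}" using slab by auto
      then show ?thesis by simp
    qed
  qed
  also have "\<dots> = ennreal (2 * pi * \<delta>) * ennreal (4 * \<delta>)"
    using \<delta> by (simp add: nn_integral_cmult)
  also have "\<dots> = ennreal (8 * pi * \<delta>\<^sup>2)"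
    using \<delta> by (simp add: power2_eq_square flip: ennreal_mult)
  finally show ?thesis unfolding S_def .
qed

text \<open>
  Both shells are rotation invariant, so \<open>z\<close> may be rotated onto the first axis.
\<close>

lemma emeasure_shell_intersection_le:
  fixes z :: "real^3"
  assumes \<delta>: "0 < \<delta>" "\<delta> \<le> 1" and z: "norm z \<ge> 1 / 2"
  shows "emeasure lborel (shell_intersection \<delta> z) \<le> ennreal (8 * pi * \<delta>\<^sup>2)"
proof -
  define e where "e = (axis 1 (norm z) :: real^3)"
  have "norm e = norm z" by (simp add: e_def norm_eq_sqrt_inner inner_axis_axis)
  then obtain R where R: "orthogonal_transformation R" "R e = z"
    using orthogonal_transformation_exists by blast
  have image: "R ` shell_intersection \<delta> e = shell_intersection \<delta> z"
  proof -
    have n: "norm (R x) = norm x" for x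
      using R(1) by (simp add: orthogonal_transformation)
    have d: "R (e - x) = z - R x" for x
      using R by (simp add: orthogonal_transformation_linear linear_diff)
    have "surj R" using R(1) by (rule orthogonal_transformation_surj)
    have "R x \<in> shell_intersection \<delta> z \<longleftrightarrow> x \<in> shell_intersection \<delta> e" for x
      using n[of x] n[of "e - x"] unfolding d shell_intersection_def by simp
    with \<open>surj R\<close> show ?thesis by (auto simp: image_iff) (metis surjD)
  qed
  have e_le: "emeasure lborel (shell_intersection \<delta> e) \<le> ennreal (8 * pi * \<delta>\<^sup>2)"
    unfolding e_def by (rule emeasure_shell_intersection_axis_le[OF \<delta> z])
  have lmeas: "shell_intersection \<delta> e \<in> lmeasurable"
    using le_less_trans[OF e_le ennreal_less_top]
    by (intro fmeasurableI) (auto simp: emeasure_completion)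
  have "emeasure lborel (shell_intersection \<delta> z) = emeasure lebesgue (R ` shell_intersection \<delta> e)"
    unfolding image by (simp add: emeasure_completion)
  also have "\<dots> = emeasure lebesgue (shell_intersection \<delta> e)"
    using measure_orthogonal_image[OF R(1) lmeas] measurable_orthogonal_image[OF R(1) lmeas] lmeas
    by (simp add: emeasure_eq_measure2)
  also have "\<dots> \<le> ennreal (8 * pi * \<delta>\<^sup>2)"
    using e_le by (simp add: emeasure_completion)
  finally show ?thesis .
qed


definition orthant_shell :: "real \<Rightarrow> 'a::euclidean_space set \<Rightarrow> 'a set" where
  "orthant_shell \<delta> J = {x. 1 - \<delta> < norm x \<and> norm x \<le> 1} \<inter> orthant J"

lemma orthant_shell_borel [measurable]: "orthant_shell \<delta> J \<in> sets borel"
  unfolding orthant_shell_def by measurable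

text \<open>
  Substituting \<open>z = x + y\<close> and integrating over \<open>x\<close> first leaves the volume of a shell intersection.
  Only \<open>z\<close> that are sums of two points of the orthant shell contribute, and for these the
  nonnegative inner product forces \<open>|z| \<ge> 1/2\<close>, the range of the volume bound.
\<close>

lemma shell_convolution_le:
  fixes F :: "real^3 \<Rightarrow> ennreal"
  assumes [measurable]: "F \<in> borel_measurable borel" and \<delta>: "0 < \<delta>" "\<delta> \<le> 1 / 2"
  shows "(\<integral>\<^sup>+x. (\<integral>\<^sup>+y. F (x + y) * indicator (orthant_shell \<delta> J) y \<partial>lborel) * indicator (orthant_shell \<delta> J) x \<partial>lborel)
    \<le> ennreal (8 * pi * \<delta>\<^sup>2) * (\<integral>\<^sup>+z. F z \<partial>lborel)"
proof -
  let ?S = "orthant_shell \<delta> J"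
  have "(\<integral>\<^sup>+x. (\<integral>\<^sup>+y. F (x + y) * indicator ?S y \<partial>lborel) * indicator ?S x \<partial>lborel)
      = (\<integral>\<^sup>+x. (\<integral>\<^sup>+z. F z * (indicator ?S (z - x) * indicator ?S x) \<partial>lborel) \<partial>lborel)"
  proof (intro nn_integral_cong)
    fix x
    have "(\<integral>\<^sup>+y. F (x + y) * indicator ?S y \<partial>lborel) = (\<integral>\<^sup>+z. F z * indicator ?S (z - x) \<partial>lborel)"
      using nn_integral_translate[of "\<lambda>z. F z * indicator ?S (z - x)" x] by simp
    then show "(\<integral>\<^sup>+y. F (x + y) * indicator ?S y \<partial>lborel) * indicator ?S x
        = (\<integral>\<^sup>+z. F z * (indicator ?S (z - x) * indicator ?S x) \<partial>lborel)"
      by (simp add: nn_integral_multc mult.assoc[symmetric])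
  qed
  also have "\<dots> = (\<integral>\<^sup>+z. F z * (\<integral>\<^sup>+x. indicator ?S (z - x) * indicator ?S x \<partial>lborel) \<partial>lborel)"
    by (subst lborel_pair.Fubini') (simp_all add: nn_integral_cmult)
  also have "\<dots> \<le> (\<integral>\<^sup>+z. F z * ennreal (8 * pi * \<delta>\<^sup>2) \<partial>lborel)"
  proof (intro nn_integral_mono mult_left_mono)
    fix z :: "real^3"
    show "(\<integral>\<^sup>+x. indicator ?S (z - x) * indicator ?S x \<partial>lborel) \<le> ennreal (8 * pi * \<delta>\<^sup>2)"
    proof (cases "\<exists>x. x \<in> ?S \<and> z - x \<in> ?S")
      case True
      then obtain x where x: "x \<in> ?S" "z - x \<in> ?S" by blast
      have "(1 / 2)\<^sup>2 \<le> (norm x)\<^sup>2"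
        using x \<delta> by (intro power_mono) (auto simp: orthant_shell_def)
      also have "(norm x)\<^sup>2 \<le> (norm x)\<^sup>2 + 2 * (x \<bullet> (z - x)) + (norm (z - x))\<^sup>2"
        using orthant_inner_nonneg[of x J "z - x"] x by (simp add: orthant_shell_def)
      also have "\<dots> = (norm z)\<^sup>2"
        by (simp add: power2_norm_eq_inner inner_diff inner_commute)
      finally have "norm z \<ge> 1 / 2" by (rule power2_le_imp_le) simp
      have "(\<integral>\<^sup>+x. indicator ?S (z - x) * indicator ?S x \<partial>lborel)
          \<le> (\<integral>\<^sup>+x. indicator (shell_intersection \<delta> z) x \<partial>lborel)"
        by (intro nn_integral_mono) (auto simp: orthant_shell_def shell_intersection_def split: split_indicator)
      also have "\<dots> \<le> ennreal (8 * pi * \<delta>\<^sup>2)"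
        using emeasure_shell_intersection_le[OF _ _ \<open>norm z \<ge> 1 / 2\<close>] \<delta> by simp
      finally show ?thesis .
    next
      case False
      then have "indicator ?S (z - x) * indicator ?S x = (0 :: ennreal)" for x
        by (auto split: split_indicator)
      then have "(\<integral>\<^sup>+x. indicator ?S (z - x) * indicator ?S x \<partial>lborel) = (\<integral>\<^sup>+x. 0 \<partial>(lborel :: (real^3) measure))"
        by (intro nn_integral_cong)
      then show ?thesis by simp
    qed
  qed simp
  also have "\<dots> = ennreal (8 * pi * \<delta>\<^sup>2) * (\<integral>\<^sup>+z. F z \<partial>lborel)"
    by (simp add: nn_integral_multc mult.commute)
  finally show ?thesis .
qed

lemma orthant_integral_le_shell:
  fixes F :: "'a::euclidean_space \<Rightarrow> ennreal"
  assumes [measurable]: "F \<in> borel_measurable borel" and \<delta>: "0 < \<delta>" "\<delta> < 1"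
    and fin: "(\<integral>\<^sup>+x. F x \<partial>orthant_measure J) < \<infinity>"
  shows "ennreal \<delta> * (\<integral>\<^sup>+x. F x \<partial>orthant_measure J)
    \<le> of_nat DIM('a) * (\<integral>\<^sup>+x. F (sgn x) * indicator (orthant_shell \<delta> J) x \<partial>lborel)"
proof -
  have "ennreal \<delta> * (\<integral>\<^sup>+x. F x \<partial>orthant_measure J) \<le> of_nat DIM('a) *
     (\<integral>\<^sup>+x. (F (sgn x) * indicator (orthant J) (sgn x)) * indicator {x. 1 - \<delta> < norm x \<and> norm x \<le> 1} x \<partial>lborel)"
    using sphere_integral_le_shell[of "\<lambda>x. F x * indicator (orthant J) x" \<delta>] fin \<delta>
    by (simp add: nn_integral_orthant_measure)
  also have "(\<integral>\<^sup>+x. (F (sgn x) * indicator (orthant J) (sgn x)) * indicator {x. 1 - \<delta> < norm x \<and> norm x \<le> 1} x \<partial>lborel)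
    = (\<integral>\<^sup>+x. F (sgn x) * indicator (orthant_shell \<delta> J) x \<partial>lborel)"
  proof (intro nn_integral_cong)
    fix x :: 'a
    have "x \<noteq> 0" if "1 - \<delta> < norm x" using that \<delta> by auto
    then show "(F (sgn x) * indicator (orthant J) (sgn x)) * indicator {x. 1 - \<delta> < norm x \<and> norm x \<le> 1} x
        = F (sgn x) * indicator (orthant_shell \<delta> J) x"
      by (auto simp: orthant_shell_def orthant_sgn split: split_indicator)
  qed
  finally show ?thesis .
qed

text \<open>
  On an open set the surface measure is compared with the thickened one. The set is exhausted by
  closed sets \<open>V k\<close> whose points have distance at least \<open>1 / (k + 1)\<close> from the complement; if two
  points on the sphere have their sum in \<open>V k\<close> and each is moved radially by less than
  \<open>\<delta> = 1 / (2 (k + 1))\<close>, the new sum is still in \<open>U\<close>. The two factors \<open>\<delta>\<close> lost by thickening are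
  exactly compensated by the factor \<open>\<delta>\<^sup>2\<close> in the volume bound, and \<open>72 = 3 \<cdot> 3 \<cdot> 8\<close>.
\<close>

lemma orthant_convolution_open_le:
  fixes U :: "(real^3) set"
  assumes U: "open U"
  shows "emeasure (distr (orthant_measure J \<Otimes>\<^sub>M orthant_measure J) borel (\<lambda>(x, y). x + y)) U
    \<le> ennreal (72 * pi) * emeasure lborel U"
proof -
  interpret J: finite_measure "orthant_measure J" by (rule finite_orthant_measure)
  interpret JJ: pair_sigma_finite "orthant_measure J" "orthant_measure J" ..
  define \<Lambda> where "\<Lambda> = distr (orthant_measure J \<Otimes>\<^sub>M orthant_measure J) borel (\<lambda>(x, y). x + y)"
  have [measurable]: "U \<in> sets borel" using U by simp
  have \<Lambda>: "emeasure \<Lambda> E = (\<integral>\<^sup>+x. (\<integral>\<^sup>+y. indicator E (x + y) \<partial>orthant_measure J) \<partial>orthant_measure J)"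
    if [measurable]: "E \<in> sets borel" for E
  proof -
    have "emeasure \<Lambda> E = (\<integral>\<^sup>+z. indicator E z \<partial>\<Lambda>)" by (simp add: \<Lambda>_def)
    also have "\<dots> = (\<integral>\<^sup>+p. indicator E (fst p + snd p) \<partial>(orthant_measure J \<Otimes>\<^sub>M orthant_measure J))"
      unfolding \<Lambda>_def by (subst nn_integral_distr) (simp_all add: split_beta)
    also have "\<dots> = (\<integral>\<^sup>+x. (\<integral>\<^sup>+y. indicator E (x + y) \<partial>orthant_measure J) \<partial>orthant_measure J)"
      by (subst J.nn_integral_fst[symmetric]) simp_all
    finally show ?thesis .
  qed
  define V where "V = (\<lambda>k::nat. {z. \<forall>w. dist z w < 1 / real (Suc k) \<longrightarrow> w \<in> U})"
  have "closed (V k)" for k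
  proof -
    have "- V k = (\<Union>w\<in>-U. ball w (1 / real (Suc k)))"
      by (auto simp: V_def dist_commute)
    then show ?thesis by (metis open_UN open_ball closed_open)
  qed
  then have V_borel [measurable]: "V k \<in> sets borel" for k by simp
  have "incseq V"
  proof (rule incseq_SucI)
    fix k
    have "1 / real (Suc (Suc k)) \<le> 1 / real (Suc k)" by (simp add: field_simps)
    then show "V k \<subseteq> V (Suc k)" unfolding V_def by (blast intro: less_le_trans)
  qed
  have UN_V: "(\<Union>k. V k) = U"
  proof
    show "(\<Union>k. V k) \<subseteq> U" by (auto simp: V_def)
    show "U \<subseteq> (\<Union>k. V k)"
    proof
      fix z assume "z \<in> U"
      then obtain e where e: "e > 0" "ball z e \<subseteq> U" using U openE by blast
      obtain k where "1 / real (Suc k) < e"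
        using reals_Archimedean[OF e(1)] by (auto simp: inverse_eq_divide)
      then have "z \<in> V k" using e(2) by (auto simp: V_def)
      then show "z \<in> (\<Union>k. V k)" by blast
    qed
  qed
  have V_le: "emeasure \<Lambda> (V k) \<le> ennreal (72 * pi) * emeasure lborel U" for k
  proof -
    define \<delta> where "\<delta> = 1 / (2 * real (Suc k))"
    have \<delta>: "0 < \<delta>" "\<delta> \<le> 1 / 2" "\<delta> < 1" by (auto simp: \<delta>_def field_simps)
    let ?S = "orthant_shell \<delta> J"
    have near: "x + y \<in> U" if "sgn x + sgn y \<in> V k" "x \<in> ?S" "y \<in> ?S" for x y
    proof -
      have close: "norm (sgn x - x) < \<delta>" if "x \<in> ?S" for x :: "real^3"
      proof -
        have "x \<noteq> 0" using that \<delta> by (auto simp: orthant_shell_def)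
        then have "sgn x - x = (1 - norm x) *\<^sub>R sgn x"
          by (simp add: sgn_div_norm scaleR_diff_left left_diff_distrib)
        then have "norm (sgn x - x) = \<bar>1 - norm x\<bar>" using \<open>x \<noteq> 0\<close> by (simp add: norm_sgn)
        then show ?thesis using that by (auto simp: orthant_shell_def)
      qed
      have "\<delta> + \<delta> = 1 / real (Suc k)" by (simp add: \<delta>_def field_simps)
      have "norm ((sgn x - x) + (sgn y - y)) < \<delta> + \<delta>"
        using close[OF that(2)] close[OF that(3)] norm_triangle_ineq[of "sgn x - x" "sgn y - y"] by linarith
      then have "dist (sgn x + sgn y) (x + y) < 1 / real (Suc k)"
        using \<open>\<delta> + \<delta> = 1 / real (Suc k)\<close> by (simp add: dist_norm algebra_simps)
      then show ?thesis using that(1) by (auto simp: V_def)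
    qed
    have inner: "ennreal \<delta> * (\<integral>\<^sup>+y. indicator (V k) (x + y) \<partial>orthant_measure J)
        \<le> 3 * (\<integral>\<^sup>+y. indicator (V k) (x + sgn y) * indicator ?S y \<partial>lborel)" for x
    proof -
      have "(\<integral>\<^sup>+y. indicator (V k) (x + y) \<partial>orthant_measure J) \<le> (\<integral>\<^sup>+y. 1 \<partial>orthant_measure J)"
        by (intro nn_integral_mono) (simp split: split_indicator)
      also have "\<dots> < \<infinity>" using le_less_trans[OF emeasure_orthant_measure_le[of J] ennreal_less_top] by simp
      finally show ?thesis
        using orthant_integral_le_shell[of "\<lambda>y. indicator (V k) (x + y)" \<delta> J] \<delta> by simp
    qed
    have \<Lambda>_fin: "emeasure \<Lambda> (V k) < \<infinity>"
    proof -
      interpret JP: finite_measure "orthant_measure J \<Otimes>\<^sub>M orthant_measure J"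
        by (intro finite_measure_pair_measure J.finite_measure_axioms)
      show ?thesis unfolding \<Lambda>_def
        by (subst emeasure_distr) (auto simp: JP.emeasure_finite less_top[symmetric])
    qed
    have "ennreal \<delta> * (ennreal \<delta> * emeasure \<Lambda> (V k))
       \<le> ennreal \<delta> * (3 * (\<integral>\<^sup>+x. (\<integral>\<^sup>+y. indicator (V k) (sgn x + y) \<partial>orthant_measure J) * indicator ?S x \<partial>lborel))"
      using orthant_integral_le_shell[of "\<lambda>x. \<integral>\<^sup>+y. indicator (V k) (x + y) \<partial>orthant_measure J" \<delta> J] \<delta> \<Lambda>_fin
      by (intro mult_left_mono) (simp_all add: \<Lambda>)
    also have "\<dots> = 3 * (\<integral>\<^sup>+x. (ennreal \<delta> * (\<integral>\<^sup>+y. indicator (V k) (sgn x + y) \<partial>orthant_measure J)) * indicator ?S x \<partial>lborel)"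
      by (simp add: nn_integral_cmult mult.assoc mult.left_commute)
    also have "\<dots> \<le> 3 * (\<integral>\<^sup>+x. (3 * (\<integral>\<^sup>+y. indicator (V k) (sgn x + sgn y) * indicator ?S y \<partial>lborel)) * indicator ?S x \<partial>lborel)"
      by (intro mult_left_mono nn_integral_mono mult_right_mono inner) simp_all
    also have "\<dots> \<le> 3 * (\<integral>\<^sup>+x. (3 * (\<integral>\<^sup>+y. indicator U (x + y) * indicator ?S y \<partial>lborel)) * indicator ?S x \<partial>lborel)"
    proof (intro mult_left_mono nn_integral_mono)
      fix x
      show "(3 * (\<integral>\<^sup>+y. indicator (V k) (sgn x + sgn y) * indicator ?S y \<partial>lborel)) * indicator ?S x
        \<le> (3 * (\<integral>\<^sup>+y. indicator U (x + y) * indicator ?S y \<partial>lborel)) * indicator ?S x"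
      proof (cases "x \<in> ?S")
        case True
        then show ?thesis
          using near[of x] by (auto intro!: mult_left_mono nn_integral_mono split: split_indicator)
      qed simp
    qed simp
    also have "\<dots> = 9 * (\<integral>\<^sup>+x. (\<integral>\<^sup>+y. indicator U (x + y) * indicator ?S y \<partial>lborel) * indicator ?S x \<partial>lborel)"
      by (simp add: nn_integral_cmult mult.assoc)
    also have "\<dots> \<le> 9 * (ennreal (8 * pi * \<delta>\<^sup>2) * (\<integral>\<^sup>+z. indicator U z \<partial>lborel))"
      by (intro mult_left_mono shell_convolution_le \<delta>) simp_all
    also have "\<dots> = ennreal (9 * (8 * pi * \<delta>\<^sup>2)) * emeasure lborel U"
      by (simp add: mult.assoc[symmetric] ennreal_mult' del: ennreal_mult'')
    also have "\<dots> = ennreal \<delta> * (ennreal \<delta> * (ennreal (72 * pi) * emeasure lborel U))"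
    proof -
      have "9 * (8 * pi * \<delta>\<^sup>2) = \<delta> * (\<delta> * (72 * pi))" by (simp add: power2_eq_square)
      then show ?thesis using \<delta> by (simp add: ennreal_mult mult_ac)
    qed
    finally show ?thesis
      using \<delta> by (simp add: ennreal_mult_le_mult_iff)
  qed
  have "emeasure \<Lambda> U = (SUP k. emeasure \<Lambda> (V k))"
    using SUP_emeasure_incseq[of V \<Lambda>] \<open>incseq V\<close> UN_V by (auto simp: \<Lambda>_def image_subset_iff)
  also have "\<dots> \<le> ennreal (72 * pi) * emeasure lborel U"
    by (intro SUP_least V_le)
  finally show ?thesis unfolding \<Lambda>_def .
qed

text \<open>
  Outer regularity of Lebesgue measure extends the comparison from open sets to Borel sets, and
  hence to integrals: within one orthant, \<open>\<sigma> * \<sigma>\<close> has a density bounded by \<open>72 \<pi>\<close>.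
\<close>

theorem orthant_convolution_le:
  fixes F :: "real^3 \<Rightarrow> ennreal"
  assumes [measurable]: "F \<in> borel_measurable borel"
  shows "(\<integral>\<^sup>+x. (\<integral>\<^sup>+y. F (x + y) \<partial>orthant_measure J) \<partial>orthant_measure J)
    \<le> ennreal (72 * pi) * (\<integral>\<^sup>+z. F z \<partial>lborel)"
proof -
  interpret J: finite_measure "orthant_measure J" by (rule finite_orthant_measure)
  define \<Lambda> where "\<Lambda> = distr (orthant_measure J \<Otimes>\<^sub>M orthant_measure J) borel (\<lambda>(x, y). x + y)"
  have "emeasure \<Lambda> E \<le> ennreal (72 * pi) * emeasure lborel E" if E: "E \<in> sets borel" for E
  proof (rule ennreal_le_epsilon)
    fix e :: real assume "e > 0"
    obtain U where U: "open U" "E \<subseteq> U" "emeasure lborel (U - E) < ennreal (e / (72 * pi))"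
      using outer_regular_lborel[OF E, of "e / (72 * pi)"] \<open>e > 0\<close> by auto
    have "emeasure \<Lambda> E \<le> emeasure \<Lambda> U"
      using U(1,2) by (intro emeasure_mono) (auto simp: \<Lambda>_def)
    also have "\<dots> \<le> ennreal (72 * pi) * emeasure lborel U"
      unfolding \<Lambda>_def by (rule orthant_convolution_open_le[OF U(1)])
    also have "emeasure lborel U = emeasure lborel E + emeasure lborel (U - E)"
      using U(1,2) E by (subst plus_emeasure) (auto simp: Un_absorb1)
    also have "ennreal (72 * pi) * \<dots> \<le> ennreal (72 * pi) * (emeasure lborel E + ennreal (e / (72 * pi)))"
      using U(3) by (intro mult_left_mono add_left_mono) auto
    also have "\<dots> = ennreal (72 * pi) * emeasure lborel E + ennreal e"
      using \<open>e > 0\<close> by (simp add: distrib_left flip: ennreal_mult)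
    finally show "emeasure \<Lambda> E \<le> ennreal (72 * pi) * emeasure lborel E + ennreal e" .
  qed
  then have "\<Lambda> \<le> scale_measure (ennreal (72 * pi)) lborel"
    by (subst le_measure) (auto simp: \<Lambda>_def le_fun_def sets_scale_measure)
  then have "(\<integral>\<^sup>+z. F z \<partial>\<Lambda>) \<le> (\<integral>\<^sup>+z. F z \<partial>scale_measure (ennreal (72 * pi)) lborel)"
    by (intro nn_integral_mono_measure) (auto simp: \<Lambda>_def sets_scale_measure)
  also have "\<dots> = ennreal (72 * pi) * (\<integral>\<^sup>+z. F z \<partial>lborel)"
    by (rule nn_integral_scale_measure) simp
  also have "(\<integral>\<^sup>+z. F z \<partial>\<Lambda>) = (\<integral>\<^sup>+p. F (fst p + snd p) \<partial>(orthant_measure J \<Otimes>\<^sub>M orthant_measure J))"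
    unfolding \<Lambda>_def by (subst nn_integral_distr) (simp_all add: split_beta)
  also have "\<dots> = (\<integral>\<^sup>+x. (\<integral>\<^sup>+y. F (x + y) \<partial>orthant_measure J) \<partial>orthant_measure J)"
    by (subst J.nn_integral_fst[symmetric]) simp_all
  finally show ?thesis .
qed

section \<open>The maximal function along rational times\<close>

lemma epowr_two: "epowr x 2 = x\<^sup>2"
  by (cases x) (auto simp: epowr_def ennreal_power ennreal_mult powr_numeral power2_eq_square)

lemma epowr_half_square: "(epowr x (1 / 2))\<^sup>2 = x"
proof (cases x)
  case (real r)
  then show ?thesis
    by (auto simp: epowr_def ennreal_power powr_half_sqrt)
qed (auto simp: epowr_def power2_eq_square)

lemma Lp_enorm_two_square: "(Lp_enorm 2 M F)\<^sup>2 = (\<integral>\<^sup>+x. (F x)\<^sup>2 \<partial>M)"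
  unfolding Lp_enorm_def epowr_half_square epowr_two ..

lemma ennreal_power2_le_imp_le:
  fixes x y :: ennreal
  assumes "x\<^sup>2 \<le> y\<^sup>2"
  shows "x \<le> y"
proof (cases x; cases y)
  fix a b :: real
  assume ab: "0 \<le> a" "x = ennreal a" "0 \<le> b" "y = ennreal b"
  then have "a\<^sup>2 \<le> b\<^sup>2" using assms by (simp add: ennreal_power)
  then show ?thesis using ab by (auto intro!: ennreal_leI power2_le_imp_le)
qed (use assms in \<open>auto simp: power2_eq_square top_unique ennreal_mult_eq_top_iff\<close>)

text \<open>
  Boundedness on \<open>L\<^sup>2\<close> with squared norms, which are plain integrals.
\<close>

definition maximal_L2_const :: "'a::euclidean_space measure \<Rightarrow> real \<Rightarrow> bool" where
  "maximal_L2_const \<mu> A \<longleftrightarrow> A > 0 \<and> (\<forall>g\<in>borel_measurable borel.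
     (\<integral>\<^sup>+x. ennreal ((norm (g x))\<^sup>2) \<partial>lborel) < \<infinity> \<longrightarrow>
     (\<integral>\<^sup>+x. (maximal_fun \<mu> g x)\<^sup>2 \<partial>lborel) \<le> ennreal A * (\<integral>\<^sup>+x. ennreal ((norm (g x))\<^sup>2) \<partial>lborel))"

lemma maximal_L2_const_exists:
  assumes "maximal_bounded_L2 \<mu>"
  shows "\<exists>A. maximal_L2_const \<mu> A"
proof -
  obtain B where B: "\<And>g. g \<in> borel_measurable borel \<Longrightarrow>
     Lp_enorm 2 lborel (\<lambda>x. ennreal (norm (g x))) < \<infinity> \<Longrightarrow>
     Lp_enorm 2 lborel (maximal_fun \<mu> g) \<le> ennreal B * Lp_enorm 2 lborel (\<lambda>x. ennreal (norm (g x)))"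
    using assms unfolding maximal_bounded_L2_def by blast
  define A where "A = (\<bar>B\<bar> + 1)\<^sup>2"
  show ?thesis
    unfolding maximal_L2_const_def
  proof (intro exI[of _ A] conjI ballI impI)
    show "A > 0" by (simp add: A_def)
    fix g :: "'a \<Rightarrow> complex"
    assume g: "g \<in> borel_measurable borel" and fin: "(\<integral>\<^sup>+x. ennreal ((norm (g x))\<^sup>2) \<partial>lborel) < \<infinity>"
    let ?N = "Lp_enorm 2 lborel (\<lambda>x. ennreal (norm (g x)))"
    have N: "?N\<^sup>2 = (\<integral>\<^sup>+x. ennreal ((norm (g x))\<^sup>2) \<partial>lborel)"
      by (simp add: Lp_enorm_two_square ennreal_power)
    then have "?N < \<infinity>"
      using fin by (cases "?N") (auto simp: power2_eq_square)
    from B[OF g this] have "Lp_enorm 2 lborel (maximal_fun \<mu> g) \<le> ennreal (\<bar>B\<bar> + 1) * ?N"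
      by (rule order.trans) (intro mult_right_mono ennreal_leI, auto)
    then have "(Lp_enorm 2 lborel (maximal_fun \<mu> g))\<^sup>2 \<le> (ennreal (\<bar>B\<bar> + 1) * ?N)\<^sup>2"
      by (intro power_mono) auto
    then show "(\<integral>\<^sup>+x. (maximal_fun \<mu> g x)\<^sup>2 \<partial>lborel) \<le> ennreal A * (\<integral>\<^sup>+x. ennreal ((norm (g x))\<^sup>2) \<partial>lborel)"
      by (simp only: Lp_enorm_two_square power_mult_distrib N A_def ennreal_power norm_ge_zero abs_ge_zero add_nonneg_nonneg zero_le_one)
  qed
qed

text \<open>
  An enumeration of the positive rationals. Countably many times keep every supremum below
  measurable.
\<close>

definition rational_time :: "nat \<Rightarrow> real" where
  "rational_time = from_nat_into (\<rat> \<inter> {0<..})"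

lemma range_rational_time: "range rational_time = \<rat> \<inter> {0<..}"
  unfolding rational_time_def
  by (rule range_from_nat_into) (auto intro: exI[of _ 1] countable_Int1 countable_rat)

lemma rational_time_pos: "rational_time n > 0"
  using range_rational_time by (metis IntE greaterThan_iff rangeI)

lemma abs_conv_dilate:
  assumes [measurable]: "g \<in> borel_measurable borel" and \<mu>[measurable_cong]: "sets \<mu> = sets borel"
  shows "abs_conv g (dilate t \<mu>) x = (\<integral>\<^sup>+y. ennreal (norm (g (x - t *\<^sub>R y))) \<partial>\<mu>)"
proof -
  have "(\<lambda>y. t *\<^sub>R y) \<in> borel_measurable \<mu>" by measurable
  then show ?thesis
    unfolding abs_conv_def dilate_def by (subst nn_integral_distr) simp_all
qed

lemma abs_conv_le_maximal_fun: "t > 0 \<Longrightarrow> abs_conv g (dilate t \<mu>) x \<le> maximal_fun \<mu> g x"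
  unfolding maximal_fun_def by (intro SUP_upper) simp

text \<open>
  For a continuous function the averages are lower semicontinuous in \<open>t\<close> by Fatou's lemma, so a
  dense set of times already gives the supremum.
\<close>

lemma maximal_fun_eq_rational:
  fixes g :: "'a::euclidean_space \<Rightarrow> complex"
  assumes g: "continuous_on UNIV g" and \<mu>[measurable_cong]: "sets \<mu> = sets borel"
  shows "maximal_fun \<mu> g x = (SUP n. abs_conv g (dilate (rational_time n) \<mu>) x)"
proof (rule antisym)
  have [measurable]: "g \<in> borel_measurable borel"
    using g by (rule borel_measurable_continuous_onI)
  show "maximal_fun \<mu> g x \<le> (SUP n. abs_conv g (dilate (rational_time n) \<mu>) x)"
    unfolding maximal_fun_def
  proof (rule SUP_least)
    fix t :: real assume "t \<in> {0<..}"
    then have "t > 0" by simp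
    have "\<exists>n. t < rational_time n \<and> rational_time n < t + 1 / real (Suc k)" for k
    proof -
      obtain r where "r \<in> \<rat>" "t < r" "r < t + 1 / real (Suc k)"
        using Rats_dense_in_real[of t "t + 1 / real (Suc k)"] by auto
      then show ?thesis
        using \<open>t > 0\<close> range_rational_time by (auto simp: set_eq_iff image_iff) (metis less_trans)
    qed
    then obtain m where m: "\<And>k. t < rational_time (m k)" "\<And>k. rational_time (m k) < t + 1 / real (Suc k)"
      by metis
    have lim: "(\<lambda>k. rational_time (m k)) \<longlonglongrightarrow> t"
    proof (rule tendsto_sandwich[of "\<lambda>k. t" _ _ "\<lambda>k. t + 1 / real (Suc k)"])
      show "(\<lambda>k. t + 1 / real (Suc k)) \<longlonglongrightarrow> t"
        using tendsto_add[OF tendsto_const LIMSEQ_inverse_real_of_nat, of t] by (simp add: inverse_eq_divide)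
    qed (use m in \<open>auto intro!: always_eventually less_imp_le\<close>)
    have g_lim: "(\<lambda>k. ennreal (norm (g (x - rational_time (m k) *\<^sub>R y)))) \<longlonglongrightarrow> ennreal (norm (g (x - t *\<^sub>R y)))" for y
      by (intro tendsto_ennrealI tendsto_norm continuous_on_tendsto_compose[OF g] tendsto_intros lim) auto
    have "abs_conv g (dilate t \<mu>) x
        = (\<integral>\<^sup>+y. liminf (\<lambda>k. ennreal (norm (g (x - rational_time (m k) *\<^sub>R y)))) \<partial>\<mu>)"
      by (simp add: abs_conv_dilate[OF _ \<mu>] lim_imp_Liminf[OF trivial_limit_sequentially g_lim])
    also have "\<dots> \<le> liminf (\<lambda>k. abs_conv g (dilate (rational_time (m k)) \<mu>) x)"
      unfolding abs_conv_dilate[OF \<open>g \<in> borel_measurable borel\<close> \<mu>]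
      by (rule nn_integral_liminf) simp
    also have "\<dots> \<le> limsup (\<lambda>k. abs_conv g (dilate (rational_time (m k)) \<mu>) x)"
      by (rule Liminf_le_Limsup) simp
    also have "\<dots> \<le> (SUP n. abs_conv g (dilate (rational_time n) \<mu>) x)"
      by (intro Limsup_bounded always_eventually allI SUP_upper) auto
    finally show "abs_conv g (dilate t \<mu>) x \<le> (SUP n. abs_conv g (dilate (rational_time n) \<mu>) x)" .
  qed
  show "(SUP n. abs_conv g (dilate (rational_time n) \<mu>) x) \<le> maximal_fun \<mu> g x"
    by (intro SUP_least abs_conv_le_maximal_fun rational_time_pos)
qed

text \<open>
  The majorant \<open>H\<close> is the maximal function of the maximal function of \<open>g\<close>, both over rational
  times. This makes the inner one a Borel function, finite since \<open>g\<close> and \<open>\<mu>\<close> are bounded, to which the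
  hypothesis on \<open>\<mu>\<close> applies once more. The first average is dominated by the inner
  supremum at every point \<open>z - s y\<close>, the second by the outer supremum at \<open>z\<close>.
\<close>

lemma iterated_maximal_majorant:
  fixes g :: "'a::euclidean_space \<Rightarrow> complex"
  assumes fin: "finite_measure \<mu>" and \<mu>[measurable_cong]: "sets \<mu> = sets borel"
    and maximal: "maximal_L2_const \<mu> A"
    and g[measurable]: "g \<in> borel_measurable borel" and bounded: "\<And>x. norm (g x) \<le> B"
    and L2: "(\<integral>\<^sup>+x. ennreal ((norm (g x))\<^sup>2) \<partial>lborel) < \<infinity>"
  obtains H :: "'a \<Rightarrow> ennreal" where "H \<in> borel_measurable borel"
    "\<And>z s t. s \<in> range rational_time \<Longrightarrow> t \<in> range rational_time \<Longrightarrow>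
      (\<integral>\<^sup>+y. (\<integral>\<^sup>+y'. ennreal (norm (g (z - s *\<^sub>R y - t *\<^sub>R y'))) \<partial>\<mu>) \<partial>\<mu>) \<le> H z"
    "(\<integral>\<^sup>+x. (H x)\<^sup>2 \<partial>lborel) \<le> ennreal (A\<^sup>2) * (\<integral>\<^sup>+x. ennreal ((norm (g x))\<^sup>2) \<partial>lborel)"
proof -
  interpret finite_measure \<mu> by fact
  have A: "A > 0" "\<And>g. g \<in> borel_measurable borel \<Longrightarrow> (\<integral>\<^sup>+x. ennreal ((norm (g x))\<^sup>2) \<partial>lborel) < \<infinity> \<Longrightarrow>
      (\<integral>\<^sup>+x. (maximal_fun \<mu> g x)\<^sup>2 \<partial>lborel) \<le> ennreal A * (\<integral>\<^sup>+x. ennreal ((norm (g x))\<^sup>2) \<partial>lborel)"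
    using maximal by (auto simp: maximal_L2_const_def)
  define m where "m x = (SUP n. abs_conv g (dilate (rational_time n) \<mu>) x)" for x
  have m_le: "m x \<le> maximal_fun \<mu> g x" for x
    unfolding m_def by (intro SUP_least abs_conv_le_maximal_fun rational_time_pos)
  have [measurable]: "m \<in> borel_measurable borel"
    unfolding m_def[abs_def] abs_conv_dilate[OF g \<mu>] by measurable
  have "m x \<le> ennreal B * emeasure \<mu> UNIV" for x
    unfolding m_def abs_conv_dilate[OF g \<mu>]
  proof (rule SUP_least)
    fix n
    have "(\<integral>\<^sup>+y. ennreal (norm (g (x - rational_time n *\<^sub>R y))) \<partial>\<mu>) \<le> (\<integral>\<^sup>+y. ennreal B \<partial>\<mu>)"
      by (intro nn_integral_mono ennreal_leI bounded)
    also have "\<dots> = ennreal B * emeasure \<mu> UNIV"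
      using sets_eq_imp_space_eq[OF \<mu>] by simp
    finally show "(\<integral>\<^sup>+y. ennreal (norm (g (x - rational_time n *\<^sub>R y))) \<partial>\<mu>) \<le> ennreal B * emeasure \<mu> UNIV" .
  qed
  also have "ennreal B * emeasure \<mu> UNIV < \<infinity>"
  proof -
    have "emeasure \<mu> UNIV < top" by (simp add: less_top[symmetric] emeasure_finite)
    then show ?thesis by (simp add: ennreal_mult_less_top)
  qed
  finally have m_fin: "m x < \<infinity>" for x .
  \<comment> \<open>The maximal function takes complex arguments, so the first supremum is read as a complex function.\<close>
  define h where "h x = complex_of_real (enn2real (m x))" for x
  have [measurable]: "h \<in> borel_measurable borel" unfolding h_def[abs_def] by measurable
  have h: "ennreal (norm (h x)) = m x" for x
    using m_fin[of x] by (simp add: h_def)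
  then have h2: "ennreal ((norm (h x))\<^sup>2) = (m x)\<^sup>2" for x
    by (metis ennreal_power norm_ge_zero)
  define H where "H x = (SUP n. abs_conv h (dilate (rational_time n) \<mu>) x)" for x
  have m_L2: "(\<integral>\<^sup>+x. (m x)\<^sup>2 \<partial>lborel) \<le> ennreal A * (\<integral>\<^sup>+x. ennreal ((norm (g x))\<^sup>2) \<partial>lborel)"
    by (rule order.trans[OF nn_integral_mono A(2)[OF g L2]]) (intro power_mono m_le, simp)
  show thesis
  proof
    show "H \<in> borel_measurable borel"
      unfolding H_def[abs_def] abs_conv_dilate[OF \<open>h \<in> borel_measurable borel\<close> \<mu>] by measurable
    show "(\<integral>\<^sup>+y. (\<integral>\<^sup>+y'. ennreal (norm (g (z - s *\<^sub>R y - t *\<^sub>R y'))) \<partial>\<mu>) \<partial>\<mu>) \<le> H z"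
      if st: "s \<in> range rational_time" "t \<in> range rational_time" for z s t
    proof -
      have "(\<integral>\<^sup>+y. (\<integral>\<^sup>+y'. ennreal (norm (g (z - s *\<^sub>R y - t *\<^sub>R y'))) \<partial>\<mu>) \<partial>\<mu>)
          \<le> (\<integral>\<^sup>+y. ennreal (norm (h (z - s *\<^sub>R y))) \<partial>\<mu>)"
        unfolding h m_def using st(2)
        by (intro nn_integral_mono) (auto intro!: SUP_upper simp: abs_conv_dilate[OF g \<mu>, symmetric])
      also have "\<dots> \<le> H z"
        unfolding H_def using st(1)
        by (auto intro!: SUP_upper simp: abs_conv_dilate[OF \<open>h \<in> borel_measurable borel\<close> \<mu>, symmetric])
      finally show ?thesis .
    qed
    have "(\<integral>\<^sup>+x. (H x)\<^sup>2 \<partial>lborel) \<le> (\<integral>\<^sup>+x. (maximal_fun \<mu> h x)\<^sup>2 \<partial>lborel)"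
      unfolding H_def
      by (intro nn_integral_mono power_mono SUP_least abs_conv_le_maximal_fun rational_time_pos) simp
    also have "\<dots> \<le> ennreal A * (\<integral>\<^sup>+x. ennreal ((norm (h x))\<^sup>2) \<partial>lborel)"
      unfolding h2
    proof (rule A(2)[of h, unfolded h2])
      show "(\<integral>\<^sup>+x. (m x)\<^sup>2 \<partial>lborel) < \<infinity>"
        by (rule le_less_trans[OF m_L2]) (use L2 in \<open>auto simp: ennreal_mult_less_top\<close>)
    qed simp
    also have "\<dots> \<le> ennreal A * (ennreal A * (\<integral>\<^sup>+x. ennreal ((norm (g x))\<^sup>2) \<partial>lborel))"
      unfolding h2 by (intro mult_left_mono m_L2) simp
    also have "\<dots> = ennreal (A\<^sup>2) * (\<integral>\<^sup>+x. ennreal ((norm (g x))\<^sup>2) \<partial>lborel)"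
      using A(1) by (simp add: power2_eq_square ennreal_mult mult.assoc)
    finally show "(\<integral>\<^sup>+x. (H x)\<^sup>2 \<partial>lborel) \<le> ennreal (A\<^sup>2) * (\<integral>\<^sup>+x. ennreal ((norm (g x))\<^sup>2) \<partial>lborel)" .
  qed
qed

section \<open>An inequality of Hoelder type\<close>

text \<open>
  A substitute for Hoelder's inequality that treats all exponents \<open>1 \<le> p \<le> 4/3\<close> at once. Where
  \<open>F \<ge> 1\<close>, already \<open>F \<le> F\<^sup>p\<close>, and \<open>k \<le> c\<close>. Where \<open>F < 1\<close>, either \<open>F \<le> k\<^sup>3\<close> and the product is at most
  \<open>k\<^sup>4\<close>, or \<open>k < F\<^bsup>1/3\<^esup>\<close> and it is at most \<open>F\<^bsup>4/3\<^esup> \<le> F\<^sup>p\<close>.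
\<close>

lemma mult_le_powr_plus_power4:
  fixes F k c p :: real
  assumes "F \<ge> 0" "k \<ge> 0" "k \<le> c" "1 \<le> p" "p \<le> 4 / 3"
  shows "F * k \<le> (c + 1) * F powr p + k ^ 4"
proof (cases "F \<ge> 1")
  case True
  have "F * k \<le> F powr p * (c + 1)"
    using assms True powr_mono[of 1 p F] by (intro mult_mono) auto
  also have "\<dots> = (c + 1) * F powr p" by simp
  finally show ?thesis using zero_le_power[OF assms(2), of 4] by linarith
next
  case False
  show ?thesis
  proof (cases "F \<le> k ^ 3")
    case True
    have "F * k \<le> k ^ 3 * k" using True assms by (intro mult_right_mono) auto
    also have "\<dots> = k ^ 4" by (simp add: power_numeral_reduce)
    finally show ?thesis using assms by (smt (verit) mult_nonneg_nonneg powr_ge_zero)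
  next
    case False
    then have "F > 0" using assms zero_le_power[of k 3] by linarith
    have "k \<le> F powr (1 / 3)"
    proof -
      have "k ^ 3 \<le> (F powr (1 / 3)) ^ 3"
        using False \<open>F > 0\<close> by (simp add: powr_power)
      then show ?thesis by (rule power_le_imp_le_base[of _ 2, simplified numeral_3_eq_3[symmetric] numeral_2_eq_2])
          (auto simp: eval_nat_numeral)
    qed
    then have "F * k \<le> F powr 1 * F powr (1 / 3)"
      using assms by (auto intro: mult_left_mono)
    also have "\<dots> = F powr (4 / 3)" by (simp only: powr_add[symmetric]) simp
    also have "\<dots> \<le> F powr p"
      using \<open>\<not> F \<ge> 1\<close> assms \<open>F > 0\<close> by (intro powr_mono') auto
    also have "\<dots> \<le> (c + 1) * F powr p"
      using mult_right_mono[of 1 "c + 1" "F powr p"] assms by simp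
    finally show ?thesis using zero_le_power[OF assms(2), of 4] by linarith
  qed
qed

text \<open>
  The pointwise inequality is applied to \<open>f / \<parallel>f\<parallel>\<^sub>p\<close>, which makes it homogeneous.
\<close>

lemma nn_integral_mult_le_Lp_enorm:
  fixes f k :: "'a \<Rightarrow> real"
  assumes [measurable]: "f \<in> borel_measurable M" "k \<in> borel_measurable M"
    and f: "\<And>x. f x \<ge> 0" and k: "\<And>x. 0 \<le> k x" "\<And>x. k x \<le> c"
    and C: "C \<ge> 0" "(\<integral>\<^sup>+x. ennreal (k x ^ 4) \<partial>M) \<le> ennreal C"
    and p: "1 \<le> p" "p \<le> 4 / 3"
  shows "(\<integral>\<^sup>+x. ennreal (f x * k x) \<partial>M) \<le> ennreal (c + 1 + C) * Lp_enorm p M (\<lambda>x. ennreal (f x))"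
proof -
  have "c \<ge> 0" using k[of undefined] by linarith
  define I where "I = (\<integral>\<^sup>+x. ennreal (f x powr p) \<partial>M)"
  have Lp: "Lp_enorm p M (\<lambda>x. ennreal (f x)) = epowr I (1 / p)"
    unfolding Lp_enorm_def I_def by (simp add: epowr_def f)
  consider "I = \<infinity>" | "I = 0" | r where "I = ennreal r" "r > 0"
    by (cases I) (auto simp: less_eq_real_def)
  then show ?thesis
  proof cases
    case 1
    then show ?thesis using \<open>c \<ge> 0\<close> C(1) by (simp add: Lp epowr_def ennreal_mult_eq_top_iff ennreal_mult_top)
  next
    case 2
    then have "AE x in M. ennreal (f x powr p) = 0"
      unfolding I_def by (subst (asm) nn_integral_0_iff_AE) auto
    then have "AE x in M. ennreal (f x * k x) = 0"
      by eventually_elim (use f in \<open>auto simp: powr_eq_0_iff\<close>)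
    then have "(\<integral>\<^sup>+x. ennreal (f x * k x) \<partial>M) = 0"
      by (subst nn_integral_0_iff_AE) auto
    then show ?thesis by simp
  next
    case (3 r)
    define L where "L = r powr (1 / p)"
    have "L > 0" using 3 by (simp add: L_def)
    have Lp_L: "L powr p = r" using 3 p by (simp add: L_def powr_powr)
    have "(\<integral>\<^sup>+x. ennreal (f x * k x) \<partial>M)
        \<le> (\<integral>\<^sup>+x. ennreal L * (ennreal ((c + 1) / r) * ennreal (f x powr p) + ennreal (k x ^ 4)) \<partial>M)"
    proof (rule nn_integral_mono)
      fix x
      have "f x * k x = L * (f x / L * k x)" using \<open>L > 0\<close> by simp
      also have "\<dots> \<le> L * ((c + 1) * (f x / L) powr p + k x ^ 4)"
        using \<open>L > 0\<close> f k p by (intro mult_left_mono mult_le_powr_plus_power4) auto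
      also have "(c + 1) * (f x / L) powr p = (c + 1) / r * f x powr p"
        using f[of x] \<open>L > 0\<close> by (simp add: powr_divide Lp_L)
      finally have "ennreal (f x * k x) \<le> ennreal (L * ((c + 1) / r * f x powr p + k x ^ 4))"
        by (rule ennreal_leI)
      also have "\<dots> = ennreal L * (ennreal ((c + 1) / r) * ennreal (f x powr p) + ennreal (k x ^ 4))"
        using \<open>L > 0\<close> 3 \<open>c \<ge> 0\<close> k(1)[of x] by (simp flip: ennreal_mult ennreal_plus)
      finally show "ennreal (f x * k x) \<le> \<dots>" .
    qed
    also have "\<dots> = ennreal L * (ennreal ((c + 1) / r) * I + (\<integral>\<^sup>+x. ennreal (k x ^ 4) \<partial>M))"
      unfolding I_def by (simp add: nn_integral_cmult nn_integral_add)
    also have "\<dots> \<le> ennreal L * (ennreal ((c + 1) / r) * I + ennreal C)"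
      by (intro mult_left_mono add_left_mono C) auto
    also have "\<dots> = ennreal L * ennreal (c + 1 + C)"
      using 3 \<open>c \<ge> 0\<close> C(1) by (simp flip: ennreal_mult ennreal_plus)
    also have "\<dots> = ennreal (c + 1 + C) * Lp_enorm p M (\<lambda>x. ennreal (f x))"
      using 3 by (simp add: Lp epowr_def L_def mult.commute)
    finally show ?thesis .
  qed
qed

section \<open>Fourier transforms of pushed-forward measures\<close>

text \<open>
  The Fourier transform of the complex measure that is the image of \<open>W dP\<close> under \<open>\<phi>\<close>.
\<close>

definition fourier_pushforward :: "'b measure \<Rightarrow> ('b \<Rightarrow> 'a::euclidean_space) \<Rightarrow> ('b \<Rightarrow> complex) \<Rightarrow> 'a \<Rightarrow> complex" where
  "fourier_pushforward P \<phi> W \<xi> = (\<integral>p. W p * character (\<phi> p) \<xi> \<partial>P)"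

lemma norm_fourier_pushforward_le:
  "ennreal (norm (fourier_pushforward P \<phi> W \<xi>)) \<le> (\<integral>\<^sup>+p. ennreal (norm (W p)) \<partial>P)"
  unfolding fourier_pushforward_def
  by (rule order.trans[OF norm_integral_le_nn_integral]) (simp add: norm_mult)

lemma measurable_fourier_pushforward:
  assumes "sigma_finite_measure P" and [measurable]: "\<phi> \<in> borel_measurable P" "W \<in> borel_measurable P"
  shows "fourier_pushforward P \<phi> W \<in> borel_measurable borel"
proof -
  interpret sigma_finite_measure P by fact
  show ?thesis unfolding fourier_pushforward_def[abs_def] by measurable
qed

text \<open>
  Characters are multiplicative, so squaring the transform amounts to taking the convolution square
  of the measure.
\<close>

lemma fourier_pushforward_square:
  assumes "finite_measure P" and [measurable]: "\<phi> \<in> borel_measurable P" "W \<in> borel_measurable P"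
    and W: "integrable P W"
  shows "(fourier_pushforward P \<phi> W \<xi>)\<^sup>2 =
    fourier_pushforward (P \<Otimes>\<^sub>M P) (\<lambda>(p, q). \<phi> p + \<phi> q) (\<lambda>(p, q). W p * W q) \<xi>"
    and "integrable (P \<Otimes>\<^sub>M P) (\<lambda>(p, q). W p * W q)"
proof -
  interpret finite_measure P by fact
  interpret PP: pair_sigma_finite P P ..
  let ?K = "\<lambda>p. W p * character (\<phi> p) \<xi>"
  have K: "integrable P ?K"
    by (rule Bochner_Integration.integrable_bound[OF W]) (auto simp: norm_mult)
  have prod_int: "integrable (P \<Otimes>\<^sub>M P) (\<lambda>(p, q). u p * u q)"
    if u: "integrable P u" for u :: "'a \<Rightarrow> complex"
  proof (rule PP.Fubini_integrable)
    show "(\<lambda>(p, q). u p * u q) \<in> borel_measurable (P \<Otimes>\<^sub>M P)"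
      using borel_measurable_integrable[OF u] by measurable
  qed (use u in \<open>simp_all add: norm_mult\<close>)
  show "integrable (P \<Otimes>\<^sub>M P) (\<lambda>(p, q). W p * W q)" by (rule prod_int[OF W])
  have "fourier_pushforward (P \<Otimes>\<^sub>M P) (\<lambda>(p, q). \<phi> p + \<phi> q) (\<lambda>(p, q). W p * W q) \<xi>
      = (\<integral>z. (case z of (p, q) \<Rightarrow> ?K p * ?K q) \<partial>(P \<Otimes>\<^sub>M P))"
    unfolding fourier_pushforward_def
    by (intro Bochner_Integration.integral_cong) (auto simp: character_add)
  also have "\<dots> = (\<integral>p. (\<integral>q. ?K p * ?K q \<partial>P) \<partial>P)"
    using PP.integral_fst'[OF prod_int[OF K]] by simp
  also have "\<dots> = (fourier_pushforward P \<phi> W \<xi>)\<^sup>2"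
    by (simp add: fourier_pushforward_def power2_eq_square)
  finally show "(fourier_pushforward P \<phi> W \<xi>)\<^sup>2 =
    fourier_pushforward (P \<Otimes>\<^sub>M P) (\<lambda>(p, q). \<phi> p + \<phi> q) (\<lambda>(p, q). W p * W q) \<xi>" ..
qed

lemma ennreal_le_of_square_le_mult:
  fixes X D :: ennreal
  assumes "X\<^sup>2 \<le> D * X" "X < \<infinity>"
  shows "X \<le> D"
proof (cases "X = 0")
  case False
  have "X * X \<le> X * D" using assms(1) by (simp add: power2_eq_square mult.commute)
  then show ?thesis using False assms(2) by (subst (asm) ennreal_mult_le_mult_iff) auto
qed simp

text \<open>
  Duality: the fourth power of the \<open>L\<^sup>4\<close> norm of the transform \<open>K\<close> is the squared \<open>L\<^sup>2\<close> norm of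
  \<open>K\<^sup>2\<close>, tested against \<open>\<psi> = cnj (K\<^sup>2)\<close>. The test function is cut off at a ball of radius \<open>R\<close>, so
  that the quantity \<open>X\<close> to be estimated is finite and \<open>X\<^sup>2 \<le> D X\<close> yields \<open>X \<le> D\<close>; then \<open>R\<close> tends
  to infinity.
\<close>

lemma fourier_pushforward_L4_le:
  fixes \<phi> :: "'b \<Rightarrow> 'a::euclidean_space"
  assumes P: "finite_measure P" and [measurable]: "\<phi> \<in> borel_measurable P" "W \<in> borel_measurable P"
    and W: "integrable P W"
    and D: "\<And>\<psi>. integrable lborel \<psi> \<Longrightarrow> (\<integral>\<^sup>+\<xi>. ennreal ((norm (\<psi> \<xi>))\<^sup>2) \<partial>lborel) < \<infinity> \<Longrightarrow>
      (\<integral>\<^sup>+p. (\<integral>\<^sup>+q. ennreal (norm (W p) * norm (W q) * norm (fourier \<psi> (\<phi> p + \<phi> q))) \<partial>P) \<partial>P)\<^sup>2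
        \<le> D * (\<integral>\<^sup>+\<xi>. ennreal ((norm (\<psi> \<xi>))\<^sup>2) \<partial>lborel)"
  shows "(\<integral>\<^sup>+\<xi>. ennreal (norm (fourier_pushforward P \<phi> W \<xi>) ^ 4) \<partial>lborel) \<le> D"
proof -
  interpret finite_measure P by fact
  interpret PP: pair_sigma_finite P P ..
  have ball [measurable]: "ball (0 :: 'a) R \<in> sets borel" for R by simp
  define K where "K = fourier_pushforward P \<phi> W"
  have [measurable]: "K \<in> borel_measurable borel"
    unfolding K_def by (intro measurable_fourier_pushforward) (auto intro: sigma_finite_measure_axioms)
  define B where "B = (\<integral>p. norm (W p) \<partial>P)"
  have K_le: "norm (K \<xi>) \<le> B" for \<xi>
    unfolding K_def B_def fourier_pushforward_def
    by (rule order.trans[OF integral_norm_bound]) (simp add: norm_mult)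
  have X_le: "(\<integral>\<^sup>+\<xi>. ennreal (norm (K \<xi>) ^ 4) * indicator (ball 0 R) \<xi> \<partial>lborel) \<le> D" for R
  proof (rule ennreal_le_of_square_le_mult)
    define \<psi> where "\<psi> = (\<lambda>\<xi>. indicator (ball 0 R) \<xi> *\<^sub>R cnj ((K \<xi>)\<^sup>2))"
    let ?X = "\<integral>\<^sup>+\<xi>. ennreal (norm (K \<xi>) ^ 4) * indicator (ball 0 R) \<xi> \<partial>lborel"
    have K2: "(\<lambda>\<xi>. (K \<xi>)\<^sup>2) \<in> borel_measurable borel" by measurable
    have \<psi>_borel [measurable]: "\<psi> \<in> borel_measurable borel"
      unfolding \<psi>_def
      by (rule borel_measurable_scaleR[OF borel_measurable_indicator[OF ball] measurable_compose[OF K2 measurable_cnj]])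
    have ball_fin: "emeasure lborel (ball (0 :: 'a) R) < \<infinity>"
      by (rule emeasure_bounded_finite) simp
    have \<psi>: "integrable lborel \<psi>"
    proof (rule Bochner_Integration.integrable_bound)
      show "integrable lborel (\<lambda>\<xi>::'a. B\<^sup>2 * indicator (ball 0 R) \<xi>)"
        using ball_fin by (intro integrable_mult_right) (simp add: integrable_indicator_iff)
      show "AE \<xi> in lborel. norm (\<psi> \<xi>) \<le> norm (B\<^sup>2 * indicator (ball 0 R) \<xi> :: real)"
        using K_le by (auto simp: \<psi>_def norm_power indicator_def intro!: power_mono)
    qed (use \<psi>_borel in simp)
    have \<psi>_sq: "ennreal ((norm (\<psi> \<xi>))\<^sup>2) = ennreal (norm (K \<xi>) ^ 4) * indicator (ball 0 R) \<xi>" for \<xi>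
      by (simp add: \<psi>_def norm_power indicator_def flip: power_mult)
    have "?X \<le> (\<integral>\<^sup>+\<xi>. ennreal (B ^ 4) * indicator (ball (0 :: 'a) R) \<xi> \<partial>lborel)"
      using K_le by (intro nn_integral_mono mult_right_mono ennreal_leI power_mono) auto
    also have "\<dots> < \<infinity>"
      using ball ball_fin by (simp add: nn_integral_cmult_indicator ennreal_mult_less_top)
    finally show X_fin: "?X < \<infinity>" .
    have \<psi>K: "\<psi> \<xi> * (K \<xi>)\<^sup>2 = complex_of_real (norm (K \<xi>) ^ 4 * indicator (ball 0 R) \<xi>)" for \<xi>
    proof -
      have "cnj ((K \<xi>)\<^sup>2) * (K \<xi>)\<^sup>2 = complex_of_real (norm ((K \<xi>)\<^sup>2) ^ 2)"
        by (simp only: complex_norm_square mult.commute)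
      then show ?thesis by (simp add: \<psi>_def indicator_def norm_power flip: power_mult)
    qed
    have "?X = ennreal (norm (\<integral>\<xi>. \<psi> \<xi> * (K \<xi>)\<^sup>2 \<partial>lborel))"
    proof -
      have eq: "ennreal (norm (K \<xi>) ^ 4) * indicator (ball 0 R) \<xi> = ennreal (norm (K \<xi>) ^ 4 * indicator (ball 0 R) \<xi>)" for \<xi>
        by (simp add: indicator_def)
      have "integrable lborel (\<lambda>\<xi>. norm (K \<xi>) ^ 4 * indicator (ball 0 R) \<xi>)"
        using X_fin unfolding eq by (intro integrableI_nonneg) auto
      then have "?X = ennreal (\<integral>\<xi>. norm (K \<xi>) ^ 4 * indicator (ball 0 R) \<xi> \<partial>lborel)"
        unfolding eq by (intro nn_integral_eq_integral) auto
      also have "\<dots> = ennreal (norm (\<integral>\<xi>. \<psi> \<xi> * (K \<xi>)\<^sup>2 \<partial>lborel))"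
        unfolding \<psi>K integral_complex_of_real norm_of_real
        by (subst abs_of_nonneg) (auto intro!: Bochner_Integration.integral_nonneg)
      finally show ?thesis .
    qed
    also have "(\<integral>\<xi>. \<psi> \<xi> * (K \<xi>)\<^sup>2 \<partial>lborel)
        = (\<integral>z. (case z of (p, q) \<Rightarrow> W p * W q) * fourier \<psi> (case z of (p, q) \<Rightarrow> \<phi> p + \<phi> q) \<partial>(P \<Otimes>\<^sub>M P))"
      unfolding K_def fourier_pushforward_square(1)[OF P assms(2,3) W] unfolding fourier_pushforward_def
      by (rule integral_fourier_swap[OF _ _ fourier_pushforward_square(2)[OF P assms(2,3) W] \<psi>])
        (auto intro: PP.sigma_finite_measure_axioms)
    also have "ennreal (norm \<dots>) \<le> (\<integral>\<^sup>+z. ennreal (norm (W (fst z)) * norm (W (snd z)) * norm (fourier \<psi> (\<phi> (fst z) + \<phi> (snd z)))) \<partial>(P \<Otimes>\<^sub>M P))"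
      by (rule order.trans[OF norm_integral_le_nn_integral]) (simp add: norm_mult split_beta)
    also have "\<dots> = (\<integral>\<^sup>+p. (\<integral>\<^sup>+q. ennreal (norm (W p) * norm (W q) * norm (fourier \<psi> (\<phi> p + \<phi> q))) \<partial>P) \<partial>P)"
    proof -
      have [measurable]: "fourier \<psi> \<in> borel_measurable borel"
        using measurable_fourier[OF \<psi>, of "\<lambda>x. x"] by simp
      show ?thesis by (subst nn_integral_fst[symmetric]) simp_all
    qed
    finally have "?X\<^sup>2 \<le> \<dots>\<^sup>2" by (intro power_mono) auto
    also have "\<dots> \<le> D * (\<integral>\<^sup>+\<xi>. ennreal ((norm (\<psi> \<xi>))\<^sup>2) \<partial>lborel)"
      using X_fin by (intro D[OF \<psi>]) (simp add: \<psi>_sq)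
    finally show "?X\<^sup>2 \<le> D * ?X" by (simp only: \<psi>_sq)
  qed
  have lim: "(\<lambda>n. ennreal (norm (K \<xi>) ^ 4) * indicator (ball 0 (real n)) \<xi>) \<longlonglongrightarrow> ennreal (norm (K \<xi>) ^ 4)" for \<xi>
  proof (rule tendsto_eventually)
    obtain N where "norm \<xi> < real N" using reals_Archimedean2 by blast
    then show "\<forall>\<^sub>F n in sequentially. ennreal (norm (K \<xi>) ^ 4) * indicator (ball 0 (real n)) \<xi> = ennreal (norm (K \<xi>) ^ 4)"
      by (intro eventually_sequentiallyI[of N]) auto
  qed
  have "(\<integral>\<^sup>+\<xi>. ennreal (norm (K \<xi>) ^ 4) \<partial>lborel)
      = (\<integral>\<^sup>+\<xi>. liminf (\<lambda>n. ennreal (norm (K \<xi>) ^ 4) * indicator (ball 0 (real n)) \<xi>) \<partial>lborel)"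
    by (simp only: lim_imp_Liminf[OF trivial_limit_sequentially lim])
  also have "\<dots> \<le> liminf (\<lambda>n. \<integral>\<^sup>+\<xi>. ennreal (norm (K \<xi>) ^ 4) * indicator (ball 0 (real n)) \<xi> \<partial>lborel)"
    by (rule nn_integral_liminf) simp
  also have "\<dots> \<le> limsup (\<lambda>n. \<integral>\<^sup>+\<xi>. ennreal (norm (K \<xi>) ^ 4) * indicator (ball 0 (real n)) \<xi> \<partial>lborel)"
    by (rule Liminf_le_Limsup) simp
  also have "\<dots> \<le> D"
    by (intro Limsup_bounded always_eventually allI X_le)
  finally show ?thesis unfolding K_def .
qed

text \<open>
  This verifies the hypothesis of the duality lemma. The integrations over the two copies of \<open>\<mu>\<close>
  are performed first, at fixed \<open>x\<close> and \<open>x'\<close>, and are absorbed into the majorant \<open>H\<close> at the point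
  \<open>x + x'\<close>, uniformly in the chosen times. The Cauchy-Schwarz inequality then separates
  \<open>a(x) a(x')\<close> from \<open>H(x + x')\<close>, and the bounded density of \<open>\<sigma> * \<sigma>\<close> on the orthant returns the
  \<open>L\<^sup>2\<close> norm of \<open>H\<close>.
\<close>

lemma bilinear_dual_bound:
  fixes \<mu> :: "(real^3) measure" and a :: "real^3 \<Rightarrow> real" and \<tau> :: "real^3 \<Rightarrow> real"
    and J :: "(real^3) set"
  assumes fin: "finite_measure \<mu>" and \<mu>[measurable_cong]: "sets \<mu> = sets borel"
    and A: "maximal_L2_const \<mu> A"
    and [measurable]: "a \<in> borel_measurable borel" "\<tau> \<in> borel_measurable borel"
    and \<tau>: "range \<tau> \<subseteq> range rational_time" and a: "\<And>x. a x \<ge> 0"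
    and W: "\<And>x y. norm (W (x, y)) \<le> a x"
    and \<psi>: "integrable lborel \<psi>" "(\<integral>\<^sup>+\<xi>. ennreal ((norm (\<psi> \<xi>))\<^sup>2) \<partial>lborel) < \<infinity>"
  defines "P \<equiv> orthant_measure J \<Otimes>\<^sub>M \<mu>" and "\<phi> \<equiv> \<lambda>(x, y). x - \<tau> x *\<^sub>R y"
  shows "(\<integral>\<^sup>+p. (\<integral>\<^sup>+q. ennreal (norm (W p) * norm (W q) * norm (fourier \<psi> (\<phi> p + \<phi> q))) \<partial>P) \<partial>P)\<^sup>2
    \<le> (ennreal (72 * pi * A\<^sup>2) * (\<integral>\<^sup>+x. ennreal ((a x)\<^sup>2) \<partial>orthant_measure J)\<^sup>2) * (\<integral>\<^sup>+\<xi>. ennreal ((norm (\<psi> \<xi>))\<^sup>2) \<partial>lborel)"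
proof -
  interpret M: finite_measure \<mu> by fact
  interpret S: finite_measure "orthant_measure J" by (rule finite_orthant_measure)
  interpret SS: pair_sigma_finite "orthant_measure J" "orthant_measure J" ..
  interpret SM: pair_sigma_finite "orthant_measure J" \<mu> ..
  let ?\<sigma> = "orthant_measure J"
  define g where "g = fourier \<psi>"
  have [measurable]: "g \<in> borel_measurable borel"
    using measurable_fourier[OF \<psi>(1), of "\<lambda>x. x"] by (simp add: g_def)
  have g_L2: "(\<integral>\<^sup>+x. ennreal ((norm (g x))\<^sup>2) \<partial>lborel) \<le> (\<integral>\<^sup>+\<xi>. ennreal ((norm (\<psi> \<xi>))\<^sup>2) \<partial>lborel)"
    unfolding g_def by (rule fourier_L2_le[OF \<psi>(1)])
  obtain H where [measurable]: "H \<in> borel_measurable borel"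
    and H: "\<And>z s t. s \<in> range rational_time \<Longrightarrow> t \<in> range rational_time \<Longrightarrow>
      (\<integral>\<^sup>+y. (\<integral>\<^sup>+y'. ennreal (norm (g (z - s *\<^sub>R y - t *\<^sub>R y'))) \<partial>\<mu>) \<partial>\<mu>) \<le> H z"
    and H_L2: "(\<integral>\<^sup>+x. (H x)\<^sup>2 \<partial>lborel) \<le> ennreal (A\<^sup>2) * (\<integral>\<^sup>+x. ennreal ((norm (g x))\<^sup>2) \<partial>lborel)"
    using iterated_maximal_majorant[OF fin \<mu> A, of g "\<integral>x. norm (\<psi> x) \<partial>lborel"]
      norm_fourier_le[of \<psi>] le_less_trans[OF g_L2 \<psi>(2)]
    by (metis \<open>g \<in> borel_measurable borel\<close> g_def)
  have "(\<integral>\<^sup>+p. (\<integral>\<^sup>+q. ennreal (norm (W p) * norm (W q) * norm (fourier \<psi> (\<phi> p + \<phi> q))) \<partial>P) \<partial>P)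
      \<le> (\<integral>\<^sup>+p. (\<integral>\<^sup>+q. ennreal (a (fst p) * a (fst q) * norm (g (\<phi> p + \<phi> q))) \<partial>P) \<partial>P)"
    using W a unfolding g_def
    by (intro nn_integral_mono ennreal_leI mult_mono) (auto simp: split_paired_all)
  also have "\<dots> = (\<integral>\<^sup>+x. (\<integral>\<^sup>+y. (\<integral>\<^sup>+x'. (\<integral>\<^sup>+y'. ennreal (a x * a x' * norm (g ((x - \<tau> x *\<^sub>R y) + (x' - \<tau> x' *\<^sub>R y')))) \<partial>\<mu>) \<partial>?\<sigma>) \<partial>\<mu>) \<partial>?\<sigma>)"
    unfolding P_def \<phi>_def by (simp add: M.nn_integral_fst[symmetric] split_beta)
  also have "\<dots> = (\<integral>\<^sup>+x. (\<integral>\<^sup>+x'. (\<integral>\<^sup>+y. (\<integral>\<^sup>+y'. ennreal (a x * a x' * norm (g ((x - \<tau> x *\<^sub>R y) + (x' - \<tau> x' *\<^sub>R y')))) \<partial>\<mu>) \<partial>\<mu>) \<partial>?\<sigma>) \<partial>?\<sigma>)"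
    by (intro nn_integral_cong SM.Fubini') measurable
  also have "\<dots> \<le> (\<integral>\<^sup>+x. (\<integral>\<^sup>+x'. ennreal (a x * a x') * H (x + x') \<partial>?\<sigma>) \<partial>?\<sigma>)"
  proof (intro nn_integral_mono)
    fix x x'
    have "(\<integral>\<^sup>+y. (\<integral>\<^sup>+y'. ennreal (a x * a x' * norm (g ((x - \<tau> x *\<^sub>R y) + (x' - \<tau> x' *\<^sub>R y')))) \<partial>\<mu>) \<partial>\<mu>)
        = ennreal (a x * a x') * (\<integral>\<^sup>+y. (\<integral>\<^sup>+y'. ennreal (norm (g ((x + x') - \<tau> x *\<^sub>R y - \<tau> x' *\<^sub>R y'))) \<partial>\<mu>) \<partial>\<mu>)"
      using a by (simp add: ennreal_mult nn_integral_cmult algebra_simps)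
    also have "\<dots> \<le> ennreal (a x * a x') * H (x + x')"
      using \<tau> by (intro mult_left_mono H) auto
    finally show "(\<integral>\<^sup>+y. (\<integral>\<^sup>+y'. ennreal (a x * a x' * norm (g ((x - \<tau> x *\<^sub>R y) + (x' - \<tau> x' *\<^sub>R y')))) \<partial>\<mu>) \<partial>\<mu>)
        \<le> ennreal (a x * a x') * H (x + x')" .
  qed
  also have "\<dots> = (\<integral>\<^sup>+z. ennreal (a (fst z) * a (snd z)) * H (fst z + snd z) \<partial>(?\<sigma> \<Otimes>\<^sub>M ?\<sigma>))"
    by (subst S.nn_integral_fst[symmetric]) simp_all
  finally have "(\<integral>\<^sup>+p. (\<integral>\<^sup>+q. ennreal (norm (W p) * norm (W q) * norm (fourier \<psi> (\<phi> p + \<phi> q))) \<partial>P) \<partial>P)\<^sup>2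
      \<le> \<dots>\<^sup>2" by (intro power_mono) auto
  also have "\<dots> \<le> (\<integral>\<^sup>+z. (ennreal (a (fst z) * a (snd z)))\<^sup>2 \<partial>(?\<sigma> \<Otimes>\<^sub>M ?\<sigma>)) * (\<integral>\<^sup>+z. (H (fst z + snd z))\<^sup>2 \<partial>(?\<sigma> \<Otimes>\<^sub>M ?\<sigma>))"
    by (rule Cauchy_Schwarz_nn_integral) measurable
  also have "(\<integral>\<^sup>+z. (ennreal (a (fst z) * a (snd z)))\<^sup>2 \<partial>(?\<sigma> \<Otimes>\<^sub>M ?\<sigma>)) = (\<integral>\<^sup>+x. ennreal ((a x)\<^sup>2) \<partial>?\<sigma>)\<^sup>2"
  proof -
    have "(\<integral>\<^sup>+z. (ennreal (a (fst z) * a (snd z)))\<^sup>2 \<partial>(?\<sigma> \<Otimes>\<^sub>M ?\<sigma>))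
        = (\<integral>\<^sup>+x. (\<integral>\<^sup>+x'. ennreal ((a x)\<^sup>2) * ennreal ((a x')\<^sup>2) \<partial>?\<sigma>) \<partial>?\<sigma>)"
      using a by (subst S.nn_integral_fst[symmetric])
        (auto simp: ennreal_power power_mult_distrib ennreal_mult)
    also have "\<dots> = (\<integral>\<^sup>+x. ennreal ((a x)\<^sup>2) \<partial>?\<sigma>)\<^sup>2"
      by (simp add: nn_integral_cmult nn_integral_multc power2_eq_square)
    finally show ?thesis .
  qed
  also have "(\<integral>\<^sup>+z. (H (fst z + snd z))\<^sup>2 \<partial>(?\<sigma> \<Otimes>\<^sub>M ?\<sigma>))
      = (\<integral>\<^sup>+x. (\<integral>\<^sup>+x'. (H (x + x'))\<^sup>2 \<partial>?\<sigma>) \<partial>?\<sigma>)"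
    by (subst S.nn_integral_fst[symmetric]) simp_all
  also have "(\<integral>\<^sup>+x. ennreal ((a x)\<^sup>2) \<partial>?\<sigma>)\<^sup>2 * (\<integral>\<^sup>+x. (\<integral>\<^sup>+x'. (H (x + x'))\<^sup>2 \<partial>?\<sigma>) \<partial>?\<sigma>)
      \<le> (\<integral>\<^sup>+x. ennreal ((a x)\<^sup>2) \<partial>?\<sigma>)\<^sup>2 * (ennreal (72 * pi) * (ennreal (A\<^sup>2) * (\<integral>\<^sup>+\<xi>. ennreal ((norm (\<psi> \<xi>))\<^sup>2) \<partial>lborel)))"
  proof (intro mult_left_mono)
    have "(\<integral>\<^sup>+x. (\<integral>\<^sup>+x'. (H (x + x'))\<^sup>2 \<partial>?\<sigma>) \<partial>?\<sigma>) \<le> ennreal (72 * pi) * (\<integral>\<^sup>+x. (H x)\<^sup>2 \<partial>lborel)"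
      by (rule orthant_convolution_le) simp
    also have "\<dots> \<le> ennreal (72 * pi) * (ennreal (A\<^sup>2) * (\<integral>\<^sup>+\<xi>. ennreal ((norm (\<psi> \<xi>))\<^sup>2) \<partial>lborel))"
      by (intro mult_left_mono order.trans[OF H_L2] g_L2) auto
    finally show "(\<integral>\<^sup>+x. (\<integral>\<^sup>+x'. (H (x + x'))\<^sup>2 \<partial>?\<sigma>) \<partial>?\<sigma>) \<le> \<dots>" .
  qed simp
  also have "\<dots> = (ennreal (72 * pi * A\<^sup>2) * (\<integral>\<^sup>+x. ennreal ((a x)\<^sup>2) \<partial>?\<sigma>)\<^sup>2) * (\<integral>\<^sup>+\<xi>. ennreal ((norm (\<psi> \<xi>))\<^sup>2) \<partial>lborel)"
    by (subst ennreal_mult) (auto simp: mult_ac)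
  finally show ?thesis .
qed

section \<open>The linearised estimate and the theorem\<close>

text \<open>
  With \<open>\<alpha>\<^sup>2\<close> the integral of \<open>a\<^sup>2\<close>, duality gives \<open>\<alpha>\<^sup>2 \<le> \<integral> |f| |K|\<close>, while \<open>|K| / \<alpha>\<close> is bounded and
  has a bounded \<open>L\<^sup>4\<close> norm, with constants that depend on \<open>\<mu>\<close> only. So the integral is at most a
  constant times \<open>\<alpha> \<parallel>f\<parallel>\<^sub>p\<close>, and a factor \<open>\<alpha>\<close> cancels because \<open>\<alpha>\<close> is finite. The summands
  of the constant are the supremum bound, the 1 of the Hoelder-type inequality, and the bound for
  the fourth power of the \<open>L\<^sup>4\<close> norm.
\<close>

lemma orthant_linearised_estimate:
  fixes \<mu> :: "(real^3) measure" and f :: "real^3 \<Rightarrow> complex" and \<tau> :: "real^3 \<Rightarrow> real"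
    and J :: "(real^3) set"
  assumes fin: "finite_measure \<mu>" and \<mu>[measurable_cong]: "sets \<mu> = sets borel"
    and A: "maximal_L2_const \<mu> A"
    and p: "1 \<le> p" "p \<le> 4 / 3"
    and f: "integrable lborel f"
    and \<tau>_borel[measurable]: "\<tau> \<in> borel_measurable borel" and \<tau>: "range \<tau> \<subseteq> range rational_time"
  shows "(\<integral>\<^sup>+x. (\<integral>\<^sup>+y. ennreal (norm (fourier f (x - \<tau> x *\<^sub>R y))) \<partial>\<mu>)\<^sup>2 \<partial>orthant_measure J)
    \<le> (ennreal (sqrt (4 * pi) * measure \<mu> UNIV + 1 + 72 * pi * A\<^sup>2) * Lp_enorm p lborel (\<lambda>x. ennreal (norm (f x))))\<^sup>2"
proof -
  interpret M: finite_measure \<mu> by fact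
  interpret S: finite_measure "orthant_measure J" by (rule finite_orthant_measure)
  interpret SM: pair_sigma_finite "orthant_measure J" \<mu> ..
  let ?\<sigma> = "orthant_measure J"
  define P where "P = ?\<sigma> \<Otimes>\<^sub>M \<mu>"
  have finP: "finite_measure P"
    unfolding P_def by (intro finite_measure_pair_measure fin S.finite_measure_axioms)
  interpret P: finite_measure P by (rule finP)
  have [measurable_cong]: "sets P = sets (borel \<Otimes>\<^sub>M borel)"
    unfolding P_def by (intro sets_pair_measure_cong) (simp_all add: \<mu>)
  have f_borel[measurable]: "f \<in> borel_measurable borel"
    using f by (simp add: borel_measurable_integrable[of lborel, simplified])
  define F where "F = fourier f"
  have F_borel[measurable]: "F \<in> borel_measurable borel"
    using measurable_fourier[OF f, of "\<lambda>x. x"] by (simp add: F_def)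
  define m where "m = measure \<mu> UNIV"
  have m: "emeasure \<mu> UNIV = ennreal m" "m \<ge> 0"
    unfolding m_def by (simp_all add: M.emeasure_eq_measure)
  have space_\<mu>: "space \<mu> = UNIV" using sets_eq_imp_space_eq[OF \<mu>] by simp
  define B where "B = (\<integral>x. norm (f x) \<partial>lborel)"
  have "B \<ge> 0" unfolding B_def by simp
  have F_le: "norm (F \<xi>) \<le> B" for \<xi>
    unfolding F_def B_def by (rule norm_fourier_le)
  define a where "a x = enn2real (\<integral>\<^sup>+y. ennreal (norm (F (x - \<tau> x *\<^sub>R y))) \<partial>\<mu>)" for x
  have a_borel[measurable]: "a \<in> borel_measurable borel" unfolding a_def[abs_def] by measurable
  have a_nonneg: "a x \<ge> 0" for x by (simp add: a_def)
  have inner_le: "(\<integral>\<^sup>+y. ennreal (norm (F (x - \<tau> x *\<^sub>R y))) \<partial>\<mu>) \<le> ennreal (B * m)" for x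
  proof -
    have "(\<integral>\<^sup>+y. ennreal (norm (F (x - \<tau> x *\<^sub>R y))) \<partial>\<mu>) \<le> (\<integral>\<^sup>+y. ennreal B \<partial>\<mu>)"
      by (intro nn_integral_mono ennreal_leI F_le)
    also have "\<dots> = ennreal (B * m)" using \<open>B \<ge> 0\<close> m(2) by (simp add: space_\<mu> m(1) ennreal_mult)
    finally show ?thesis .
  qed
  have a_eq: "ennreal (a x) = (\<integral>\<^sup>+y. ennreal (norm (F (x - \<tau> x *\<^sub>R y))) \<partial>\<mu>)" for x
    unfolding a_def using le_less_trans[OF inner_le[of x] ennreal_less_top] by simp
  have a_le: "a x \<le> B * m" for x
    using inner_le[of x] \<open>B \<ge> 0\<close> m(2) unfolding a_eq[symmetric] by (simp add: ennreal_le_iff)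
  define \<phi> where "\<phi> = (\<lambda>(x, y). x - \<tau> x *\<^sub>R y)"
  have \<phi>_borel[measurable]: "\<phi> \<in> borel_measurable P" unfolding \<phi>_def by measurable
  \<comment> \<open>The conjugate phase turns the integral of \<open>W F\<close> into the integral of \<open>a |F|\<close>.\<close>
  define W where "W = (\<lambda>p. complex_of_real (a (fst p)) * cnj (sgn (F (\<phi> p))))"
  have W_borel[measurable]: "W \<in> borel_measurable P" unfolding W_def by measurable
  have norm_W: "norm (W (x, y)) \<le> a x" for x y
    using a_nonneg[of x] by (simp add: W_def norm_mult norm_sgn)
  have W_int: "integrable P W"
    using order.trans[OF norm_W a_le] by (intro P.integrable_const_bound[of _ "B * m"]) auto
  define K where "K = fourier_pushforward P \<phi> W"
  have K_borel[measurable]: "K \<in> borel_measurable borel"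
    unfolding K_def by (intro measurable_fourier_pushforward) (auto intro: P.sigma_finite_measure_axioms)
  define \<alpha> where "\<alpha> = sqrt (enn2real (\<integral>\<^sup>+x. ennreal ((a x)\<^sup>2) \<partial>?\<sigma>))"
  have "\<alpha> \<ge> 0" by (simp add: \<alpha>_def)
  have \<alpha>: "(\<integral>\<^sup>+x. ennreal ((a x)\<^sup>2) \<partial>?\<sigma>) = ennreal (\<alpha>\<^sup>2)"
  proof -
    have "(\<integral>\<^sup>+x. ennreal ((a x)\<^sup>2) \<partial>?\<sigma>) \<le> (\<integral>\<^sup>+x. ennreal ((B * m)\<^sup>2) \<partial>?\<sigma>)"
      by (intro nn_integral_mono ennreal_leI power_mono a_le a_nonneg)
    also have "\<dots> < \<infinity>"
      using le_less_trans[OF emeasure_orthant_measure_le[of J] ennreal_less_top]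
      by (simp add: ennreal_mult_less_top)
    finally show ?thesis by (simp add: \<alpha>_def)
  qed
  have K_sup: "norm (K \<xi>) \<le> sqrt (4 * pi) * m * \<alpha>" for \<xi>
  proof -
    have "ennreal (norm (K \<xi>)) \<le> (\<integral>\<^sup>+p. ennreal (norm (W p)) \<partial>P)"
      unfolding K_def by (rule norm_fourier_pushforward_le)
    also have "\<dots> \<le> (\<integral>\<^sup>+p. ennreal (a (fst p)) \<partial>P)"
      using norm_W by (intro nn_integral_mono ennreal_leI) (auto simp: split_paired_all)
    also have "\<dots> = (\<integral>\<^sup>+x. ennreal (a x) * 1 \<partial>?\<sigma>) * ennreal m"
      unfolding P_def by (subst M.nn_integral_fst[symmetric]) (simp_all add: space_\<mu> m(1) nn_integral_multc)
    finally have K1: "ennreal (norm (K \<xi>)) \<le> (\<integral>\<^sup>+x. ennreal (a x) * 1 \<partial>?\<sigma>) * ennreal m" .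
    have "(\<integral>\<^sup>+x. ennreal (a x) * 1 \<partial>?\<sigma>)\<^sup>2 \<le> (\<integral>\<^sup>+x. (ennreal (a x))\<^sup>2 \<partial>?\<sigma>) * (\<integral>\<^sup>+x. 1\<^sup>2 \<partial>?\<sigma>)"
      by (rule Cauchy_Schwarz_nn_integral) measurable
    also have "\<dots> \<le> ennreal (\<alpha>\<^sup>2) * ennreal (4 * pi)"
      using emeasure_orthant_measure_le[of J] \<alpha> a_nonneg
      by (intro mult_mono) (simp_all add: ennreal_power)
    also have "\<dots> = (ennreal (sqrt (4 * pi) * \<alpha>))\<^sup>2"
      using \<open>\<alpha> \<ge> 0\<close> by (simp add: ennreal_power power_mult_distrib mult.commute flip: ennreal_mult)
    finally have "(\<integral>\<^sup>+x. ennreal (a x) * 1 \<partial>?\<sigma>) \<le> ennreal (sqrt (4 * pi) * \<alpha>)"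
      by (rule ennreal_power2_le_imp_le)
    then have "ennreal (norm (K \<xi>)) \<le> ennreal (sqrt (4 * pi) * \<alpha>) * ennreal m"
      by (intro order.trans[OF K1] mult_right_mono) auto
    also have "\<dots> = ennreal (sqrt (4 * pi) * m * \<alpha>)"
      using \<open>\<alpha> \<ge> 0\<close> m(2) by (simp add: mult_ac flip: ennreal_mult)
    finally show ?thesis using \<open>\<alpha> \<ge> 0\<close> m(2) by (subst (asm) ennreal_le_iff) auto
  qed
  have K_L4: "(\<integral>\<^sup>+\<xi>. ennreal (norm (K \<xi>) ^ 4) \<partial>lborel) \<le> ennreal (72 * pi * A\<^sup>2) * (ennreal (\<alpha>\<^sup>2))\<^sup>2"
    unfolding K_def
  proof (rule fourier_pushforward_L4_le[OF finP \<phi>_borel W_borel W_int])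
    fix \<psi> :: "real^3 \<Rightarrow> complex"
    assume "integrable lborel \<psi>" "(\<integral>\<^sup>+\<xi>. ennreal ((norm (\<psi> \<xi>))\<^sup>2) \<partial>lborel) < \<infinity>"
    from bilinear_dual_bound[OF fin \<mu> A a_borel \<tau>_borel \<tau> a_nonneg norm_W this, of J]
    show "(\<integral>\<^sup>+p. (\<integral>\<^sup>+q. ennreal (norm (W p) * norm (W q) * norm (fourier \<psi> (\<phi> p + \<phi> q))) \<partial>P) \<partial>P)\<^sup>2
        \<le> ennreal (72 * pi * A\<^sup>2) * (ennreal (\<alpha>\<^sup>2))\<^sup>2 * (\<integral>\<^sup>+\<xi>. ennreal ((norm (\<psi> \<xi>))\<^sup>2) \<partial>lborel)"
      unfolding P_def \<phi>_def \<alpha> .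
  qed
  have dual: "ennreal (\<alpha>\<^sup>2) \<le> (\<integral>\<^sup>+\<xi>. ennreal (norm (f \<xi>) * norm (K \<xi>)) \<partial>lborel)"
  proof -
    have W_F: "W p * F (\<phi> p) = complex_of_real (a (fst p) * norm (F (\<phi> p)))" for p
    proof -
      have "cnj (sgn z) * z = complex_of_real (norm z)" for z :: complex
        by (cases "z = 0") (simp_all add: sgn_div_norm scaleR_conv_of_real complex_norm_square[symmetric]
            mult.commute[of "cnj z"] power2_eq_square field_simps del: of_real_power)
      then show ?thesis by (simp add: W_def mult.assoc)
    qed
    have int: "integrable P (\<lambda>p. a (fst p) * norm (F (\<phi> p)))"
    proof (rule P.integrable_const_bound[of _ "B * m * B"])
      show "AE p in P. norm (a (fst p) * norm (F (\<phi> p))) \<le> B * m * B"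
        using a_le a_nonneg F_le \<open>B \<ge> 0\<close> m(2) by (auto simp: abs_mult intro!: always_eventually mult_mono)
    qed measurable
    have "ennreal (\<alpha>\<^sup>2) = (\<integral>\<^sup>+x. ennreal (a x) * (\<integral>\<^sup>+y. ennreal (norm (F (x - \<tau> x *\<^sub>R y))) \<partial>\<mu>) \<partial>?\<sigma>)"
      unfolding \<alpha>[symmetric] a_eq[symmetric] using a_nonneg by (simp add: power2_eq_square ennreal_mult)
    also have "\<dots> = (\<integral>\<^sup>+p. ennreal (a (fst p) * norm (F (\<phi> p))) \<partial>P)"
      unfolding P_def \<phi>_def using a_nonneg
      by (subst M.nn_integral_fst[symmetric]) (simp_all add: split_beta ennreal_mult nn_integral_cmult)
    also have "\<dots> = ennreal (\<integral>p. a (fst p) * norm (F (\<phi> p)) \<partial>P)"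
      using a_nonneg by (intro nn_integral_eq_integral int) auto
    also have "\<dots> = ennreal (norm (\<integral>p. W p * F (\<phi> p) \<partial>P))"
      unfolding W_F integral_complex_of_real norm_of_real using a_nonneg
      by (subst abs_of_nonneg) (auto intro!: Bochner_Integration.integral_nonneg)
    also have "(\<integral>p. W p * F (\<phi> p) \<partial>P) = (\<integral>\<xi>. f \<xi> * K \<xi> \<partial>lborel)"
      unfolding F_def K_def fourier_pushforward_def
      by (rule integral_fourier_swap[symmetric]) (use f W_int in \<open>auto intro: P.sigma_finite_measure_axioms\<close>)
    also have "ennreal (norm \<dots>) \<le> (\<integral>\<^sup>+\<xi>. ennreal (norm (f \<xi>) * norm (K \<xi>)) \<partial>lborel)"
      by (rule order.trans[OF norm_integral_le_nn_integral]) (simp add: norm_mult)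
    finally show ?thesis .
  qed
  define C where "C = sqrt (4 * pi) * m + 1 + 72 * pi * A\<^sup>2"
  have "ennreal \<alpha> \<le> ennreal C * Lp_enorm p lborel (\<lambda>x. ennreal (norm (f x)))"
  proof (cases "\<alpha> = 0")
    case False
    then have "\<alpha> > 0" using \<open>\<alpha> \<ge> 0\<close> by simp
    have k: "(\<integral>\<^sup>+\<xi>. ennreal (norm (f \<xi>) * (norm (K \<xi>) / \<alpha>)) \<partial>lborel)
        \<le> ennreal C * Lp_enorm p lborel (\<lambda>x. ennreal (norm (f x)))"
      unfolding C_def
    proof (rule nn_integral_mult_le_Lp_enorm)
      show "norm (K \<xi>) / \<alpha> \<le> sqrt (4 * pi) * m" for \<xi>
        using K_sup[of \<xi>] \<open>\<alpha> > 0\<close> by (simp add: field_simps)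
      have "(\<integral>\<^sup>+\<xi>. ennreal ((norm (K \<xi>) / \<alpha>) ^ 4) \<partial>lborel)
          = ennreal (1 / \<alpha> ^ 4) * (\<integral>\<^sup>+\<xi>. ennreal (norm (K \<xi>) ^ 4) \<partial>lborel)"
        using \<open>\<alpha> > 0\<close> by (subst nn_integral_cmult[symmetric]) (auto simp: power_divide simp flip: ennreal_mult)
      also have "\<dots> \<le> ennreal (1 / \<alpha> ^ 4) * (ennreal (72 * pi * A\<^sup>2) * (ennreal (\<alpha>\<^sup>2))\<^sup>2)"
        by (intro mult_left_mono K_L4) auto
      also have "\<dots> = ennreal (1 / \<alpha> ^ 4 * (72 * pi * A\<^sup>2 * (\<alpha>\<^sup>2)\<^sup>2))"
        unfolding ennreal_power[OF zero_le_power2]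
        by (simp only: ennreal_mult[symmetric] zero_le_power2 zero_le_mult_iff zero_le_divide_iff
            zero_le_power_eq_numeral pi_ge_zero zero_le_numeral zero_le_one even_numeral simp_thms)
      also have "1 / \<alpha> ^ 4 * (72 * pi * A\<^sup>2 * (\<alpha>\<^sup>2)\<^sup>2) = 72 * pi * A\<^sup>2"
        using \<open>\<alpha> > 0\<close> by (simp flip: power_mult)
      finally show "(\<integral>\<^sup>+\<xi>. ennreal ((norm (K \<xi>) / \<alpha>) ^ 4) \<partial>lborel) \<le> ennreal (72 * pi * A\<^sup>2)" .
    qed (use p \<open>\<alpha> > 0\<close> in auto)
    have "ennreal \<alpha> * ennreal \<alpha> \<le> (\<integral>\<^sup>+\<xi>. ennreal (norm (f \<xi>) * norm (K \<xi>)) \<partial>lborel)"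
      using dual \<open>\<alpha> > 0\<close> by (simp add: power2_eq_square ennreal_mult)
    also have "\<dots> = ennreal \<alpha> * (\<integral>\<^sup>+\<xi>. ennreal (norm (f \<xi>) * (norm (K \<xi>) / \<alpha>)) \<partial>lborel)"
      using \<open>\<alpha> > 0\<close> by (subst nn_integral_cmult[symmetric]) (auto simp flip: ennreal_mult)
    also have "\<dots> \<le> ennreal \<alpha> * (ennreal C * Lp_enorm p lborel (\<lambda>x. ennreal (norm (f x))))"
      by (intro mult_left_mono k) simp
    finally show ?thesis
      using \<open>\<alpha> > 0\<close> by (subst (asm) ennreal_mult_le_mult_iff) auto
  qed simp
  then have "(ennreal \<alpha>)\<^sup>2 \<le> (ennreal C * Lp_enorm p lborel (\<lambda>x. ennreal (norm (f x))))\<^sup>2"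
    by (intro power_mono) auto
  moreover have "(\<integral>\<^sup>+x. (\<integral>\<^sup>+y. ennreal (norm (fourier f (x - \<tau> x *\<^sub>R y))) \<partial>\<mu>)\<^sup>2 \<partial>?\<sigma>) = (ennreal \<alpha>)\<^sup>2"
    unfolding F_def[symmetric] a_eq[symmetric] using \<alpha> a_nonneg \<open>\<alpha> \<ge> 0\<close> by (simp add: ennreal_power)
  ultimately show ?thesis by (simp add: C_def m_def)
qed

text \<open>
  Among finitely many times, one that maximises the average can be chosen measurably in \<open>x\<close>: run
  through them and keep the best time so far.
\<close>

lemma greedy_rational_time:
  fixes F :: "'a::euclidean_space \<Rightarrow> complex"
  assumes fin: "finite_measure \<mu>" and \<mu>[measurable_cong]: "sets \<mu> = sets borel"
    and [measurable]: "F \<in> borel_measurable borel"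
  shows "\<exists>\<tau>\<in>borel_measurable borel. range \<tau> \<subseteq> range rational_time \<and>
    (\<forall>n\<le>N. \<forall>x. (\<integral>\<^sup>+y. ennreal (norm (F (x - rational_time n *\<^sub>R y))) \<partial>\<mu>)
      \<le> (\<integral>\<^sup>+y. ennreal (norm (F (x - \<tau> x *\<^sub>R y))) \<partial>\<mu>))"
proof -
  interpret finite_measure \<mu> by fact
  define U where "U t x = (\<integral>\<^sup>+y. ennreal (norm (F (x - t *\<^sub>R y))) \<partial>\<mu>)" for t :: real and x
  have U[measurable]: "(\<lambda>x. U (\<tau> x) x) \<in> borel_measurable borel" if [measurable]: "\<tau> \<in> borel_measurable borel" for \<tau>
    unfolding U_def by measurable
  have "\<exists>\<tau>\<in>borel_measurable borel. range \<tau> \<subseteq> range rational_time \<and> (\<forall>n\<le>N. \<forall>x. U (rational_time n) x \<le> U (\<tau> x) x)"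
  proof (induction N)
    case 0
    show ?case by (intro bexI[of _ "\<lambda>x. rational_time 0"]) auto
  next
    case (Suc N)
    then obtain \<tau> where \<tau>[measurable]: "\<tau> \<in> borel_measurable borel"
      and range: "range \<tau> \<subseteq> range rational_time" and le: "\<And>n x. n \<le> N \<Longrightarrow> U (rational_time n) x \<le> U (\<tau> x) x"
      by blast
    define \<tau>' where "\<tau>' x = (if U (\<tau> x) x \<le> U (rational_time (Suc N)) x then rational_time (Suc N) else \<tau> x)" for x
    have [measurable]: "(\<lambda>x. U (\<tau> x) x) \<in> borel_measurable borel" "U (rational_time (Suc N)) \<in> borel_measurable borel"
      using U[OF \<tau>] U[of "\<lambda>x. rational_time (Suc N)"] by simp_all
    have "\<tau>' \<in> borel_measurable borel" unfolding \<tau>'_def[abs_def] by measurable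
    moreover have "range \<tau>' \<subseteq> range rational_time" using range by (auto simp: \<tau>'_def)
    moreover have "U (rational_time n) x \<le> U (\<tau>' x) x" if "n \<le> Suc N" for n x
    proof (cases "n = Suc N")
      case False
      then have "U (rational_time n) x \<le> U (\<tau> x) x" using that le by simp
      then show ?thesis by (auto simp: \<tau>'_def)
    qed (auto simp: \<tau>'_def)
    ultimately show ?case by blast
  qed
  then show ?thesis unfolding U_def .
qed

theorem theorem3:
  fixes \<mu> :: "(real^3) measure" and p :: real
  assumes "finite_measure \<mu>" and "sets \<mu> = sets borel"
    and "maximal_bounded_L2 \<mu>"
    and "1 \<le> p" and "p \<le> 4 / 3"
  shows "\<exists>C::real. \<forall>f :: real^3 \<Rightarrow> complex. schwartz f \<longrightarrow>
           Lp_enorm 2 sphere_measure (maximal_fun \<mu> (fourier f))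
             \<le> ennreal C * Lp_enorm p lborel (\<lambda>x. ennreal (norm (f x)))"
proof -
  note \<mu> = assms(2)
  note [measurable_cong] = \<mu>
  interpret finite_measure \<mu> by fact
  obtain A where A: "maximal_L2_const \<mu> A"
    using maximal_L2_const_exists[OF assms(3)] by blast
  define C where "C = sqrt (4 * pi) * measure \<mu> UNIV + 1 + 72 * pi * A\<^sup>2"
  have "Lp_enorm 2 sphere_measure (maximal_fun \<mu> (fourier f))
      \<le> ennreal (3 * C) * Lp_enorm p lborel (\<lambda>x. ennreal (norm (f x)))" if "schwartz f" for f :: "real^3 \<Rightarrow> complex"
  proof (rule ennreal_power2_le_imp_le)
    have f: "integrable lborel f" by (rule schwartz_integrable[OF that])
    let ?L = "Lp_enorm p lborel (\<lambda>x. ennreal (norm (f x)))"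
    define F where "F = fourier f"
    have F: "continuous_on UNIV F" unfolding F_def by (rule continuous_fourier[OF f])
    then have F_borel[measurable]: "F \<in> borel_measurable borel"
      by (rule borel_measurable_continuous_onI)
    define u where "u n x = (\<integral>\<^sup>+y. ennreal (norm (F (x - rational_time n *\<^sub>R y))) \<partial>\<mu>)" for n x
    have u_borel[measurable]: "u n \<in> borel_measurable borel" for n unfolding u_def[abs_def] by measurable
    have max_eq: "maximal_fun \<mu> F x = (SUP n. u n x)" for x
      unfolding u_def maximal_fun_eq_rational[OF F \<mu>] abs_conv_dilate[OF F_borel \<mu>] ..
    define v where "v N x = (SUP n\<in>{..N}. u n x)" for N x
    have v_borel[measurable]: "v N \<in> borel_measurable borel" for N unfolding v_def[abs_def] by measurable
    have v_le: "(\<integral>\<^sup>+x. (v N x)\<^sup>2 \<partial>sphere_measure) \<le> 8 * (ennreal C * ?L)\<^sup>2" for N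
    proof -
      obtain \<tau> where \<tau>: "\<tau> \<in> borel_measurable borel" "range \<tau> \<subseteq> range rational_time"
        "\<And>n x. n \<le> N \<Longrightarrow> u n x \<le> (\<integral>\<^sup>+y. ennreal (norm (F (x - \<tau> x *\<^sub>R y))) \<partial>\<mu>)"
        using greedy_rational_time[OF assms(1) \<mu> F_borel, of N] unfolding u_def by blast
      have "v N x \<le> (\<integral>\<^sup>+y. ennreal (norm (F (x - \<tau> x *\<^sub>R y))) \<partial>\<mu>)" for x
        unfolding v_def using \<tau>(3) by (intro SUP_least) auto
      then have "(\<integral>\<^sup>+x. (v N x)\<^sup>2 \<partial>orthant_measure J)
          \<le> (\<integral>\<^sup>+x. (\<integral>\<^sup>+y. ennreal (norm (F (x - \<tau> x *\<^sub>R y))) \<partial>\<mu>)\<^sup>2 \<partial>orthant_measure J)" for J :: "(real^3) set"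
        by (intro nn_integral_mono power_mono) simp_all
      moreover have "(\<integral>\<^sup>+x. (\<integral>\<^sup>+y. ennreal (norm (F (x - \<tau> x *\<^sub>R y))) \<partial>\<mu>)\<^sup>2 \<partial>orthant_measure J)
          \<le> (ennreal C * ?L)\<^sup>2" for J :: "(real^3) set"
        unfolding C_def F_def
        by (rule orthant_linearised_estimate[OF assms(1) \<mu> A assms(4,5) f \<tau>(1,2)])
      ultimately have "(\<integral>\<^sup>+x. (v N x)\<^sup>2 \<partial>orthant_measure J) \<le> (ennreal C * ?L)\<^sup>2" for J :: "(real^3) set"
        by (rule order.trans)
      then have "(\<Sum>J\<in>Pow (Basis :: (real^3) set). \<integral>\<^sup>+x. (v N x)\<^sup>2 \<partial>orthant_measure J)
          \<le> of_nat (card (Pow (Basis :: (real^3) set))) * (ennreal C * ?L)\<^sup>2"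
        by (intro sum_bounded_above)
      then show ?thesis
        by (subst nn_integral_sphere_orthants) (simp_all add: card_Pow)
    qed
    have lim: "(\<lambda>N. (v N x)\<^sup>2) \<longlonglongrightarrow> (maximal_fun \<mu> F x)\<^sup>2" for x
    proof -
      have "incseq (\<lambda>N. v N x)" unfolding v_def by (intro incseq_SucI SUP_subset_mono) auto
      then have "(\<lambda>N. v N x) \<longlonglongrightarrow> (SUP N. v N x)" by (rule LIMSEQ_SUP)
      also have "(SUP N. v N x) = maximal_fun \<mu> F x"
        unfolding max_eq v_def by (intro antisym SUP_least) (auto intro: SUP_upper2 SUP_upper)
      finally have "(\<lambda>N. v N x) \<longlonglongrightarrow> maximal_fun \<mu> F x" .
      then show ?thesis unfolding power2_eq_square by (intro tendsto_mult_ennreal) auto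
    qed
    have "(Lp_enorm 2 sphere_measure (maximal_fun \<mu> F))\<^sup>2 = (\<integral>\<^sup>+x. liminf (\<lambda>N. (v N x)\<^sup>2) \<partial>sphere_measure)"
      by (simp only: Lp_enorm_two_square lim_imp_Liminf[OF trivial_limit_sequentially lim])
    also have "\<dots> \<le> liminf (\<lambda>N. \<integral>\<^sup>+x. (v N x)\<^sup>2 \<partial>sphere_measure)"
      using measurable_compose[OF measurable_ident_sphere_measure v_borel]
      by (intro nn_integral_liminf) simp
    also have "\<dots> \<le> limsup (\<lambda>N. \<integral>\<^sup>+x. (v N x)\<^sup>2 \<partial>sphere_measure)"
      by (rule Liminf_le_Limsup) simp
    also have "\<dots> \<le> 8 * (ennreal C * ?L)\<^sup>2"
      by (intro Limsup_bounded always_eventually allI v_le)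
    \<comment> \<open>The eight orthants are rounded up to nine, a perfect square.\<close>
    also have "\<dots> \<le> 9 * (ennreal C * ?L)\<^sup>2" by (intro mult_right_mono) auto
    also have "\<dots> = (ennreal (3 * C) * ?L)\<^sup>2"
    proof -
      have "C \<ge> 0" by (simp add: C_def)
      then show ?thesis by (simp add: ennreal_mult power_mult_distrib mult.assoc)
    qed
    finally show "(Lp_enorm 2 sphere_measure (maximal_fun \<mu> (fourier f)))\<^sup>2 \<le> (ennreal (3 * C) * ?L)\<^sup>2"
      unfolding F_def .
  qed
  then show ?thesis by blast
qed

end
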